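(* Let $E$ be an arbitrary directed graph, $K$ a field, and $L=L_K(E)$ the Leavitt path algebra of $E$ over $K$. If $L$ has a unique maximal ideal $M$, then $M$ is a graded ideal.
   Context: A directed graph $E=(E^0,E^1,r,s)$ consists of a set $E^0$ of vertices, a set $E^1$ of edges, and range and source maps $r,s:E^1\to E^0$ (no finiteness or cardinality assumptions). A vertex is regular if it emits a non-empty finite set of edges. The Leavitt path algebra $L_K(E)$ is the (associative, not necessarily unital) $K$-algebra generated by pairwise orthogonal idempotents $\{v: v\in E^0\}$ together with elements $\{e,e^*: e\in E^1\}$ subject to: (1) $s(e)e=e=e\,r(e)$ for all $e\in E^1$; (2) $r(e)e^*=e^*=e^*s(e)$ for all $e\in E^1$; (3) $e^*e=r(e)$ and $e^*f=0$ for $e\neq f$ in $E^1$; (4) $v=\sum_{e\in E^1,\,s(e)=v} ee^*$ for every regular vertex $v$. It has local units (finite sums of distinct vertices), and is unital iff $E^0$ is finite. $L_K(E)=\bigoplus_{n\in\mathbb{Z}} L_n$ is $\mathbb{Z}$-graded by $\deg v=0$, $\deg e=1$, $\deg e^*=-1$. Ideals are two-sided. An ideal $I$ is graded if $I=\bigoplus_{n\in\mathbb{Z}}(I\cap L_n)$. A maximal ideal is a maximal element of the set of all proper ideals of $L_K(E)$ (graded or not) ordered by inclusion. *)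

theory Defs
  imports
    "HOL-Library.Poly_Mapping"
    "HOL-Algebra.QuotRing"
    "HOL-Algebra.Module"
    "Graph_Theory.Digraph"
begin

section \<open>Algebras without unit\<close>

text \<open>
  Associative algebras that need not be unital are represented by the library record
  \<^type>\<open>module\<close>, which extends \<^type>\<open>ring\<close> by a scalar multiplication. Its field
  \<^const>\<open>one\<close> carries no meaning here: it is left undefined and nothing below refers to it.
  In particular the library's locales \<^locale>\<open>ring\<close> and \<^locale>\<open>ideal\<close>, which demand a unit,
  are not applicable.
\<close>

definition two_sided_ideal :: "'a set \<Rightarrow> ('a, 'm) ring_scheme \<Rightarrow> bool" where
  "two_sided_ideal I A \<longleftrightarrow>
     additive_subgroup I A \<and>
     (\<forall>x\<in>I. \<forall>a\<in>carrier A. a \<otimes>\<^bsub>A\<^esub> x \<in> I \<and> x \<otimes>\<^bsub>A\<^esub> a \<in> I)"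

definition proper_ideal :: "'a set \<Rightarrow> ('a, 'm) ring_scheme \<Rightarrow> bool" where
  "proper_ideal I A \<longleftrightarrow> two_sided_ideal I A \<and> I \<noteq> carrier A"

definition maximal_ideal :: "'a set \<Rightarrow> ('a, 'm) ring_scheme \<Rightarrow> bool" where
  "maximal_ideal M A \<longleftrightarrow>
     proper_ideal M A \<and> (\<forall>I. proper_ideal I A \<and> M \<subseteq> I \<longrightarrow> I = M)"

definition algebra_ideal :: "'a set \<Rightarrow> ('k, 'a) module \<Rightarrow> bool" where
  "algebra_ideal I A \<longleftrightarrow> two_sided_ideal I A \<and> (\<forall>c. \<forall>x\<in>I. c \<odot>\<^bsub>A\<^esub> x \<in> I)"

definition generated_algebra_ideal :: "'a set \<Rightarrow> ('k, 'a) module \<Rightarrow> 'a set" where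
  "generated_algebra_ideal R A = \<Inter>{I. algebra_ideal I A \<and> R \<subseteq> I}"

definition quotient_algebra :: "('k, 'a) module \<Rightarrow> 'a set \<Rightarrow> ('k, 'a set) module" where
  "quotient_algebra A J =
     \<lparr>carrier = a_rcosets\<^bsub>A\<^esub> J,
      mult = rcoset_mult A J,
      one = undefined,
      zero = J,
      add = set_add A,
      smult = (\<lambda>c X. \<Union>x\<in>X. J +>\<^bsub>A\<^esub> (c \<odot>\<^bsub>A\<^esub> x))\<rparr>"

definition internal_direct_sum :: "('a, 'm) ring_scheme \<Rightarrow> ('i \<Rightarrow> 'a set) \<Rightarrow> 'a set \<Rightarrow> bool" where
  "internal_direct_sum A T S \<longleftrightarrow>
     (\<forall>i. additive_subgroup (T i) A) \<and>
     S = {\<Oplus>\<^bsub>A\<^esub>i\<in>N. x i | N x. finite N \<and> (\<forall>i\<in>N. x i \<in> T i)} \<and>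
     (\<forall>N x. finite N \<and> (\<forall>i\<in>N. x i \<in> T i) \<and> (\<Oplus>\<^bsub>A\<^esub>i\<in>N. x i) = \<zero>\<^bsub>A\<^esub>
        \<longrightarrow> (\<forall>i\<in>N. x i = \<zero>\<^bsub>A\<^esub>))"

definition graded_ideal ::
  "('a, 'm) ring_scheme \<Rightarrow> (int \<Rightarrow> 'a set) \<Rightarrow> 'a set \<Rightarrow> bool" where
  "graded_ideal A C I \<longleftrightarrow>
     two_sided_ideal I A \<and> internal_direct_sum A (\<lambda>n. I \<inter> C n) I"


section \<open>Free algebras without unit\<close>

text \<open>
  Words form a monoid under concatenation, so that the multiplication of
  \<open>'x list \<Rightarrow>\<^sub>0 'k\<close> is that of noncommutative polynomials.
\<close>

instantiation list :: (type) monoid_add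
begin

definition zero_list :: "'a list" where "0 = []"

definition plus_list :: "'a list \<Rightarrow> 'a list \<Rightarrow> 'a list" where "xs + ys = xs @ ys"

instance
  by standard (simp_all add: zero_list_def plus_list_def)

end

text \<open>The empty word is excluded, so the free algebra on \<open>X\<close> has no unit.\<close>

definition free_algebra :: "'x set \<Rightarrow> ('k::field, 'x list \<Rightarrow>\<^sub>0 'k) module" where
  "free_algebra X =
     \<lparr>carrier = {f. \<forall>w\<in>Poly_Mapping.keys f. w \<noteq> [] \<and> set w \<subseteq> X},
      mult = (*),
      one = undefined,
      zero = 0,
      add = (+),
      smult = (\<lambda>c. Poly_Mapping.map ((*) c))\<rparr>"

definition letter :: "'x \<Rightarrow> 'x list \<Rightarrow>\<^sub>0 'k::field" where
  "letter x = Poly_Mapping.single [x] 1"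


section \<open>Leavitt path algebras\<close>

text \<open>
  For a graph \<open>G\<close>, the source and range maps are \<open>tail G\<close> and \<open>head G\<close>.
\<close>

datatype ('v, 'e) generator = Vertex 'v | Edge 'e | Ghost 'e

definition generators :: "('v, 'e) pre_digraph \<Rightarrow> ('v, 'e) generator set" where
  "generators G = Vertex ` verts G \<union> Edge ` arcs G \<union> Ghost ` arcs G"

definition regular :: "('v, 'e) pre_digraph \<Rightarrow> 'v \<Rightarrow> bool" where
  "regular G v \<longleftrightarrow> v \<in> verts G \<and> finite (out_arcs G v) \<and> out_arcs G v \<noteq> {}"

text \<open>An equation \<open>a = b\<close> between elements of the free algebra is encoded as \<open>a - b\<close>.\<close>

definition leavitt_relations ::
  "('v, 'e) pre_digraph \<Rightarrow> (('v, 'e) generator list \<Rightarrow>\<^sub>0 'k::field) set" where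
  "leavitt_relations G =
     {letter (Vertex v) * letter (Vertex v) - letter (Vertex v) | v. v \<in> verts G} \<union>
     {letter (Vertex v) * letter (Vertex w) | v w. v \<in> verts G \<and> w \<in> verts G \<and> v \<noteq> w} \<union>
     {letter (Vertex (tail G e)) * letter (Edge e) - letter (Edge e) | e. e \<in> arcs G} \<union>
     {letter (Edge e) * letter (Vertex (head G e)) - letter (Edge e) | e. e \<in> arcs G} \<union>
     {letter (Vertex (head G e)) * letter (Ghost e) - letter (Ghost e) | e. e \<in> arcs G} \<union>
     {letter (Ghost e) * letter (Vertex (tail G e)) - letter (Ghost e) | e. e \<in> arcs G} \<union>
     {letter (Ghost e) * letter (Edge e) - letter (Vertex (head G e)) | e. e \<in> arcs G} \<union>
     {letter (Ghost e) * letter (Edge f) | e f. e \<in> arcs G \<and> f \<in> arcs G \<and> e \<noteq> f} \<union>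
     {letter (Vertex v) - (\<Sum>e\<in>out_arcs G v. letter (Edge e) * letter (Ghost e)) | v. regular G v}"

definition leavitt_ideal ::
  "('v, 'e) pre_digraph \<Rightarrow> (('v, 'e) generator list \<Rightarrow>\<^sub>0 'k::field) set" where
  "leavitt_ideal G = generated_algebra_ideal (leavitt_relations G) (free_algebra (generators G))"

definition leavitt_path_algebra ::
  "('v, 'e) pre_digraph \<Rightarrow> ('k::field, (('v, 'e) generator list \<Rightarrow>\<^sub>0 'k) set) module" where
  "leavitt_path_algebra G = quotient_algebra (free_algebra (generators G)) (leavitt_ideal G)"

fun generator_degree :: "('v, 'e) generator \<Rightarrow> int" where
  "generator_degree (Vertex v) = 0"
| "generator_degree (Edge e) = 1"
| "generator_degree (Ghost e) = -1"

definition word_degree :: "('v, 'e) generator list \<Rightarrow> int" where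
  "word_degree w = (\<Sum>x\<leftarrow>w. generator_degree x)"

definition leavitt_component ::
  "('v, 'e) pre_digraph \<Rightarrow> int \<Rightarrow> (('v, 'e) generator list \<Rightarrow>\<^sub>0 'k::field) set set" where
  "leavitt_component G n =
     {leavitt_ideal G +>\<^bsub>free_algebra (generators G)\<^esub> f | f.
        f \<in> carrier (free_algebra (generators G)) \<and>
        (\<forall>w\<in>Poly_Mapping.keys f. word_degree w = n)}"

end

theory Submission
  imports Defs
begin

text \<open>
  For graded ideals \<open>J\<close> of \<open>L\<close>, every homogeneous \<open>x \<in> J\<close> satisfies \<open>x = u x\<close> for some \<open>u \<in> J\<close>.
  Consequently the largest graded ideal \<open>G\<close> inside a maximal ideal \<open>M\<close> is a maximal graded ideal.
  If \<open>M \<noteq> G\<close>, an element of \<open>M\<close> of minimal support in the graded simple ring \<open>L / G\<close> yields a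
  homogeneous central unit \<open>c\<close> of nonzero degree in a corner \<open>v (L / G) v\<close> with \<open>v \<notin> M\<close>. By degrees,
  \<open>v + c\<close> and \<open>v + c + c\<^sup>2\<close> generate ideals that avoid \<open>v\<close>, so each lies in a maximal ideal. These
  two maximal ideals differ, because together the two elements generate \<open>v\<close>.

  Ideals of \<open>L\<close> are handled as ideals of the free algebra that contain the Leavitt ideal, and
  equations in \<open>L\<close> as congruences modulo it.
\<close>

section \<open>Graded rings without unit\<close>

text \<open>The second sentence of the overview fails for general graded rings: in K[x] the maximal
  ideal (x - 1) contains no graded ideal except 0, yet 0 is not maximal among the proper graded
  ideals because of (x). The left units exclude this. They are the main place where the structure of
  L enters, and they come from writing elements as sums of products of a path and a ghost path. The
  missing unit is a second obstacle: a union of a chain of proper ideals can be everything, so a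
  proper ideal need not lie in a maximal one. Avoiding the homogeneous element \<open>v\<close>
  replaces properness, since an ideal above \<open>G\<close> that contains \<open>v\<close> is
  everything. The two polynomials in \<open>c\<close> have all coefficients equal to 1, so that they
  serve over every field; linear ones would not do, because over the field with two elements
  \<open>v + c\<close> is the only one with both coefficients nonzero. They generate
  \<open>v\<close> because 1 + c + c^2 - (1 + c) c = 1.\<close>

locale graded_subring =
  fixes S :: "'a::ring set" and part :: "int \<Rightarrow> 'a \<Rightarrow> 'a"
  assumes zero_closed [simp]: "0 \<in> S"
    and diff_closed [simp]: "x \<in> S \<Longrightarrow> y \<in> S \<Longrightarrow> x - y \<in> S"
    and mult_closed [simp]: "x \<in> S \<Longrightarrow> y \<in> S \<Longrightarrow> x * y \<in> S"
    and part_closed [simp]: "x \<in> S \<Longrightarrow> part n x \<in> S"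
    and part_add: "part n (x + y) = part n x + part n y"
    and part_part: "part m (part n x) = (if m = n then part n x else 0)"
    and finite_parts: "finite {n. part n x \<noteq> 0}"
    and sum_parts: "(\<Sum>n | part n x \<noteq> 0. part n x) = x"
    and part_mult_parts: "part (m + n) (part m x * part n y) = part m x * part n y"
begin

lemma uminus_closed [simp]: "x \<in> S \<Longrightarrow> - x \<in> S"
  using diff_closed[of 0 x] by simp

lemma add_closed [simp]: "x \<in> S \<Longrightarrow> y \<in> S \<Longrightarrow> x + y \<in> S"
  using diff_closed[of x "- y"] by simp

lemma sum_closed: "(\<And>a. a \<in> A \<Longrightarrow> f a \<in> S) \<Longrightarrow> sum f A \<in> S"
  by (induction A rule: infinite_finite_induct) auto

lemma part_zero [simp]: "part n 0 = 0"
  using part_add[of n 0 0] by simp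

lemma part_uminus: "part n (- x) = - part n x"
  using part_add[of n x "- x"] by (simp add: eq_neg_iff_add_eq_0 add.commute)

lemma part_diff: "part n (x - y) = part n x - part n y"
  using part_add[of n x "- y"] by (simp add: part_uminus)

lemma part_sum: "part n (sum f A) = (\<Sum>a\<in>A. part n (f a))"
  by (induction A rule: infinite_finite_induct) (auto simp: part_add)

text \<open>The equation \<open>part n x = x\<close> is the form in which homogeneity of degree
  \<open>n\<close> is expressed throughout; 0 satisfies it for every \<open>n\<close>.\<close>

lemma part_homogeneous: "part n x = x \<Longrightarrow> part m x = (if m = n then x else 0)"
  by (metis part_part)

text \<open>For properties that are additive in \<open>x\<close>. The base case speaks of the parts
  of the given \<open>x\<close> itself, so facts about \<open>x\<close> can still be used in
  it.\<close>

lemma homogeneous_induct [consumes 1, case_names part zero add]: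
  assumes "x \<in> S" and "\<And>n. Q (part n x)" and "Q 0"
    and "\<And>a b. a \<in> S \<Longrightarrow> b \<in> S \<Longrightarrow> Q a \<Longrightarrow> Q b \<Longrightarrow> Q (a + b)"
  shows "Q x"
proof -
  have "Q (\<Sum>n\<in>A. part n x) \<and> (\<Sum>n\<in>A. part n x) \<in> S" if "finite A" for A
    using that by induction (use assms in auto)
  then show ?thesis
    using sum_parts[of x] finite_parts[of x] by metis
qed

lemma part_mult_homogeneous:
  assumes "part m a = a" "part n b = b"
  shows "part (m + n) (a * b) = a * b"
  using part_mult_parts[of m n a b] assms by simp

lemma part_mult_left:
  assumes a: "part i a = a"
  shows "part m (a * y) = a * part (m - i) y"
proof -
  let ?N = "{n. part n y \<noteq> 0}"
  have "part m (a * y) = (\<Sum>n\<in>?N. part m (a * part n y))"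
    by (subst sum_parts[of y, symmetric]) (simp add: sum_distrib_left part_sum)
  also have "\<dots> = (\<Sum>n\<in>?N. if n = m - i then a * part n y else 0)"
  proof (rule sum.cong[OF refl])
    fix n
    have "part (i + n) (a * part n y) = a * part n y"
      by (rule part_mult_homogeneous[OF a]) (simp add: part_part)
    from part_homogeneous[OF this, of m]
    show "part m (a * part n y) = (if n = m - i then a * part n y else 0)"
      by auto
  qed
  also have "\<dots> = a * part (m - i) y"
    using finite_parts[of y] by (auto simp: sum.delta)
  finally show ?thesis .
qed

lemma part_mult_right:
  assumes b: "part i b = b"
  shows "part m (y * b) = part (m - i) y * b"
proof -
  let ?N = "{n. part n y \<noteq> 0}"
  have "part m (y * b) = (\<Sum>n\<in>?N. part m (part n y * b))"
    by (subst sum_parts[of y, symmetric]) (simp add: sum_distrib_right part_sum)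
  also have "\<dots> = (\<Sum>n\<in>?N. if n = m - i then part n y * b else 0)"
  proof (rule sum.cong[OF refl])
    fix n
    have "part (n + i) (part n y * b) = part n y * b"
      by (rule part_mult_homogeneous[OF _ b]) (simp add: part_part)
    from part_homogeneous[OF this, of m]
    show "part m (part n y * b) = (if n = m - i then part n y * b else 0)"
      by auto
  qed
  also have "\<dots> = part (m - i) y * b"
    using finite_parts[of y] by (auto simp: sum.delta)
  finally show ?thesis .
qed

section \<open>Ideals, graded ideals and the graded core\<close>

definition is_ideal :: "'a set \<Rightarrow> bool" where
  "is_ideal I \<longleftrightarrow> I \<subseteq> S \<and> 0 \<in> I \<and> (\<forall>x\<in>I. \<forall>y\<in>I. x - y \<in> I) \<and>
     (\<forall>x\<in>I. \<forall>a\<in>S. a * x \<in> I \<and> x * a \<in> I)"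

definition graded :: "'a set \<Rightarrow> bool" where
  "graded I \<longleftrightarrow> (\<forall>x\<in>I. \<forall>n. part n x \<in> I)"

lemma is_idealI:
  assumes "I \<subseteq> S" "0 \<in> I" "\<And>x y. x \<in> I \<Longrightarrow> y \<in> I \<Longrightarrow> x - y \<in> I"
    "\<And>a x. x \<in> I \<Longrightarrow> a \<in> S \<Longrightarrow> a * x \<in> I" "\<And>a x. x \<in> I \<Longrightarrow> a \<in> S \<Longrightarrow> x * a \<in> I"
  shows "is_ideal I"
  using assms unfolding is_ideal_def by blast

context
  fixes I assumes I: "is_ideal I"
begin

lemma ideal_subset: "x \<in> I \<Longrightarrow> x \<in> S"
  and ideal_zero: "0 \<in> I"
  and ideal_diff: "x \<in> I \<Longrightarrow> y \<in> I \<Longrightarrow> x - y \<in> I"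
  and ideal_mult_left: "x \<in> I \<Longrightarrow> a \<in> S \<Longrightarrow> a * x \<in> I"
  and ideal_mult_right: "x \<in> I \<Longrightarrow> a \<in> S \<Longrightarrow> x * a \<in> I"
  using I unfolding is_ideal_def by blast+

lemma ideal_uminus: "x \<in> I \<Longrightarrow> - x \<in> I"
  using ideal_diff[OF ideal_zero, of x] by simp

lemma ideal_add: "x \<in> I \<Longrightarrow> y \<in> I \<Longrightarrow> x + y \<in> I"
  using ideal_diff[of x "- y"] ideal_uminus[of y] by simp

lemma ideal_sum: "(\<And>a. a \<in> A \<Longrightarrow> f a \<in> I) \<Longrightarrow> sum f A \<in> I"
  by (induction A rule: infinite_finite_induct) (auto intro: ideal_zero ideal_add)

lemma ideal_of_parts: "(\<And>n. part n x \<in> I) \<Longrightarrow> x \<in> I"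
  using ideal_sum[of "{n. part n x \<noteq> 0}" "\<lambda>n. part n x"] sum_parts[of x] by simp

lemma ideal_diff_left_iff: "x - y \<in> I \<Longrightarrow> x \<in> I \<longleftrightarrow> y \<in> I"
  using ideal_diff[of x "x - y"] ideal_add[of "x - y" y] by auto

end

lemma is_ideal_add_sets:
  assumes I: "is_ideal I" and J: "is_ideal J"
  shows "is_ideal {x + y | x y. x \<in> I \<and> y \<in> J}"
proof (rule is_idealI)
  show "{x + y | x y. x \<in> I \<and> y \<in> J} \<subseteq> S"
    using ideal_subset[OF I] ideal_subset[OF J] by auto
  show "0 \<in> {x + y | x y. x \<in> I \<and> y \<in> J}"
    using ideal_zero[OF I] ideal_zero[OF J] by force
  fix a b assume "a \<in> {x + y | x y. x \<in> I \<and> y \<in> J}"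
  then obtain x y where a: "a = x + y" "x \<in> I" "y \<in> J" by blast
  { assume "b \<in> {x + y | x y. x \<in> I \<and> y \<in> J}"
    then obtain x' y' where b: "b = x' + y'" "x' \<in> I" "y' \<in> J" by blast
    have "a - b = (x - x') + (y - y')" using a b by simp
    then show "a - b \<in> {x + y | x y. x \<in> I \<and> y \<in> J}"
      using ideal_diff[OF I, of x x'] ideal_diff[OF J, of y y'] a b by blast }
  assume b: "b \<in> S"
  have "b * a = b * x + b * y" "a * b = x * b + y * b"
    by (simp_all add: a distrib_left distrib_right)
  moreover have "b * x \<in> I" "b * y \<in> J" "x * b \<in> I" "y * b \<in> J"
    using a b ideal_mult_left[OF I] ideal_mult_left[OF J] ideal_mult_right[OF I] ideal_mult_right[OF J]
    by auto
  ultimately show "b * a \<in> {x + y | x y. x \<in> I \<and> y \<in> J}"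
    "a * b \<in> {x + y | x y. x \<in> I \<and> y \<in> J}"
    by blast+
qed

definition core :: "'a set \<Rightarrow> 'a set" where
  "core I = {x \<in> I. \<forall>n. part n x \<in> I}"

lemma core_subset: "core I \<subseteq> I"
  by (auto simp: core_def)

lemma core_largest: "graded J \<Longrightarrow> J \<subseteq> I \<Longrightarrow> J \<subseteq> core I"
  by (auto simp: core_def graded_def)

lemma graded_core: "is_ideal I \<Longrightarrow> graded (core I)"
  by (auto simp: core_def graded_def part_part ideal_zero)

lemma is_ideal_core:
  assumes I: "is_ideal I"
  shows "is_ideal (core I)"
proof (rule is_idealI)
  show "core I \<subseteq> S" using ideal_subset[OF I] by (auto simp: core_def)
  show "0 \<in> core I" using ideal_zero[OF I] by (auto simp: core_def)
  show "x - y \<in> core I" if "x \<in> core I" "y \<in> core I" for x y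
    using that ideal_diff[OF I] by (auto simp: core_def part_diff)
  fix a x assume x: "x \<in> core I" and a: "a \<in> S"
  have x': "x \<in> I" "\<And>n. part n x \<in> I" using x by (auto simp: core_def)
  have "a * x \<in> core I \<and> x * a \<in> core I"
    using a
  proof (induction rule: homogeneous_induct)
    case (part n)
    have "part n (part n a) = part n a" by (simp add: part_part)
    then show ?case
      using x' part_closed[OF a, of n] ideal_mult_left[OF I] ideal_mult_right[OF I]
      by (auto simp: core_def part_mult_left part_mult_right)
  next
    case zero
    then show ?case using ideal_zero[OF I] by (auto simp: core_def)
  next
    case (add a b)
    then show ?case using ideal_add[OF I] by (auto simp: core_def part_add algebra_simps)
  qed
  then show "a * x \<in> core I" "x * a \<in> core I" by auto
qed

text \<open>Both sides are required to lie in \<open>S\<close>, so that congruences can be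
  multiplied and chained without separate membership conditions.\<close>

definition congr :: "'a set \<Rightarrow> 'a \<Rightarrow> 'a \<Rightarrow> bool" where
  "congr I x y \<longleftrightarrow> x \<in> S \<and> y \<in> S \<and> x - y \<in> I"

context
  fixes I assumes I: "is_ideal I"
begin

lemma congr_refl: "x \<in> S \<Longrightarrow> congr I x x"
  by (simp add: congr_def ideal_zero[OF I])

lemma congr_sym: "congr I x y \<Longrightarrow> congr I y x"
  using ideal_uminus[OF I, of "x - y"] by (auto simp: congr_def)

lemma congr_trans: "congr I x y \<Longrightarrow> congr I y z \<Longrightarrow> congr I x z"
  using ideal_add[OF I, of "x - y" "y - z"] by (auto simp: congr_def)

lemma congr_add: "congr I x y \<Longrightarrow> congr I x' y' \<Longrightarrow> congr I (x + x') (y + y')"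
  using ideal_add[OF I, of "x - y" "x' - y'"] by (auto simp: congr_def algebra_simps)

lemma congr_diff: "congr I x y \<Longrightarrow> congr I x' y' \<Longrightarrow> congr I (x - x') (y - y')"
  using ideal_diff[OF I, of "x - y" "x' - y'"] by (auto simp: congr_def algebra_simps)

lemma congr_mult: 
  assumes "congr I x y" "congr I x' y'" shows "congr I (x * x') (y * y')"
proof -
  have "x * x' - y * y' = (x - y) * x' + y * (x' - y')" by (simp add: algebra_simps)
  then show ?thesis
    using assms ideal_add[OF I] ideal_mult_left[OF I] ideal_mult_right[OF I]
    by (auto simp: congr_def)
qed

lemma congr_mult_left: "congr I x y \<Longrightarrow> a \<in> S \<Longrightarrow> congr I (a * x) (a * y)"
  by (intro congr_mult congr_refl)

lemma congr_mult_right: "congr I x y \<Longrightarrow> a \<in> S \<Longrightarrow> congr I (x * a) (y * a)"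
  by (intro congr_mult congr_refl)

lemma congr_sum: "(\<And>a. a \<in> A \<Longrightarrow> congr I (f a) (g a)) \<Longrightarrow> congr I (sum f A) (sum g A)"
  by (induction A rule: infinite_finite_induct) (auto intro: congr_add congr_refl)

lemma congr_zero_iff: "congr I x 0 \<longleftrightarrow> x \<in> I"
  using ideal_subset[OF I] by (auto simp: congr_def)

lemma congr_part: "graded I \<Longrightarrow> congr I x y \<Longrightarrow> congr I (part n x) (part n y)"
  by (auto simp: congr_def graded_def simp flip: part_diff)

lemma congr_mem_iff:
  assumes J: "is_ideal J" and "I \<subseteq> J" "congr I x y"
  shows "x \<in> J \<longleftrightarrow> y \<in> J"
  using assms ideal_diff_left_iff[OF J, of x y] by (auto simp: congr_def)

end

text \<open>The hypothesis gives a unit for one homogeneous element only. Its degree-0 part is still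
  a unit for that element, and such units are merged one part of \<open>x\<close> at a time.\<close>

lemma common_left_unit:
  assumes I: "is_ideal I" "graded I" and J: "is_ideal J" "graded J" and IJ: "I \<subseteq> J"
    and unit: "\<And>x n. x \<in> J \<Longrightarrow> part n x = x \<Longrightarrow> \<exists>u\<in>J. u * x - x \<in> I"
    and x: "x \<in> J"
  shows "\<exists>u\<in>J. part 0 u = u \<and> u * x - x \<in> I"
proof -
  have hom: "\<exists>u\<in>J. part 0 u = u \<and> u * y - y \<in> I" if y: "y \<in> J" "part n y = y" for y n
  proof -
    obtain u where u: "u \<in> J" "u * y - y \<in> I" using unit[OF y] by blast
    have "part n (u * y - y) \<in> I" using I u by (auto simp: graded_def)
    then have "part 0 u * y - y \<in> I" by (simp add: part_diff part_mult_right[OF y(2)] y(2))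
    moreover have "part 0 u \<in> J" using J u by (auto simp: graded_def)
    ultimately show ?thesis by (metis part_part)
  qed
  have parts: "part n x \<in> J" for n using J x by (auto simp: graded_def)
  have "\<exists>u\<in>J. part 0 u = u \<and> (\<forall>n\<in>N. u * part n x - part n x \<in> I)" if "finite N" for N
    using that
  proof (induction N rule: finite_induct)
    case empty
    then show ?case using ideal_zero[OF J(1)] by force
  next
    case (insert k N)
    then obtain u where u: "u \<in> J" "part 0 u = u" "\<And>n. n \<in> N \<Longrightarrow> u * part n x - part n x \<in> I"
      by blast
    \<comment> \<open>The defect of \<open>u\<close> on the new part. It is homogeneous of degree
      \<open>k\<close> because \<open>u\<close> has degree 0, so \<open>hom\<close> gives a unit
      \<open>w\<close> for it.\<close>
    let ?y = "part k x - u * part k x"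
    have y: "?y \<in> J"
      by (intro ideal_diff[OF J(1)] ideal_mult_left[OF J(1)] parts ideal_subset[OF J(1) u(1)])
    have "part k ?y = ?y"
      by (simp add: part_diff part_mult_left[OF u(2)] part_part)
    then obtain w where w: "w \<in> J" "part 0 w = w" "w * ?y - ?y \<in> I" using hom[OF y] by blast
    \<comment> \<open>Formally 1 - t = (1 - w)(1 - u): the factor 1 - u already annihilates the old
      parts modulo \<open>I\<close>, and 1 - w annihilates the defect of the new one.\<close>
    let ?t = "u + w - w * u"
    have "?t \<in> J"
      by (intro ideal_diff[OF J(1)] ideal_add[OF J(1)] ideal_mult_left[OF J(1)] u w
          ideal_subset[OF J(1) w(1)])
    moreover have "part 0 ?t = ?t"
      by (simp add: part_diff part_add part_mult_left[OF w(2)] u w)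
    moreover have "?t * part k x - part k x \<in> I"
      using w(3) by (simp add: algebra_simps)
    moreover have "?t * part n x - part n x \<in> I" if n: "n \<in> N" for n
    proof -
      have "?t * part n x - part n x = (u * part n x - part n x) - w * (u * part n x - part n x)"
        by (simp add: algebra_simps)
      then show ?thesis
        using ideal_diff[OF I(1) u(3)[OF n] ideal_mult_left[OF I(1) u(3)[OF n] ideal_subset[OF J(1) w(1)]]]
        by (simp only:)
    qed
    ultimately show ?case by blast
  qed
  from this[OF finite_parts[of x]] obtain u where u: "u \<in> J" "part 0 u = u"
    "\<And>n. part n x \<noteq> 0 \<Longrightarrow> u * part n x - part n x \<in> I"
    by blast
  have "(\<Sum>n | part n x \<noteq> 0. u * part n x - part n x) \<in> I"
    by (rule ideal_sum[OF I(1)]) (use u in auto)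
  also have "(\<Sum>n | part n x \<noteq> 0. u * part n x - part n x) = u * x - x"
    by (simp add: sum_subtractf sum_parts flip: sum_distrib_left)
  finally show ?thesis using u by blast
qed

definition maximal_over :: "'a set \<Rightarrow> 'a set \<Rightarrow> bool" where
  "maximal_over I M \<longleftrightarrow> is_ideal M \<and> I \<subseteq> M \<and> M \<noteq> S \<and>
     (\<forall>P. is_ideal P \<longrightarrow> M \<subseteq> P \<longrightarrow> P \<noteq> S \<longrightarrow> P = M)"

text \<open>If \<open>J + M = S\<close> and \<open>s = j + x\<close> is homogeneous, a left unit \<open>u\<close> of \<open>j\<close> in \<open>J\<close> gives
  \<open>s - u s = x - u x\<close>, a homogeneous element of \<open>M\<close>.\<close>

lemma core_maximal_graded:
  assumes I: "is_ideal I" "graded I" and M: "maximal_over I M"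
    and J: "is_ideal J" "graded J" "core M \<subseteq> J" "J \<noteq> core M"
    and unit: "\<And>x n. x \<in> J \<Longrightarrow> part n x = x \<Longrightarrow> \<exists>u\<in>J. u * x - x \<in> I"
  shows "J = S"
proof (rule ccontr)
  assume "J \<noteq> S"
  have M': "is_ideal M" "I \<subseteq> M" using M by (auto simp: maximal_over_def)
  have IJ: "I \<subseteq> J" using core_largest[OF I(2) M'(2)] J(3) by blast
  have nJM: "\<not> J \<subseteq> M" using core_largest[OF J(2)] J(3,4) by blast
  define P where "P = {x + y | x y. x \<in> J \<and> y \<in> M}"
  have "M \<subseteq> P" using ideal_zero[OF J(1)] by (force simp: P_def)
  moreover have JP: "J \<subseteq> P" using ideal_zero[OF M'(1)] by (force simp: P_def)
  moreover have "is_ideal P" unfolding P_def by (rule is_ideal_add_sets[OF J(1) M'(1)])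
  ultimately have P: "P = S" using M nJM by (metis maximal_over_def)
  obtain s where s: "s \<in> S" "s \<notin> J" using \<open>J \<noteq> S\<close> ideal_subset[OF J(1)] by blast
  then obtain n where n: "part n s \<notin> J" using ideal_of_parts[OF J(1)] by blast
  define t where "t = part n s"
  have t: "t \<in> S" "t \<notin> J" "part n t = t" using s n by (auto simp: t_def part_part)
  have "t \<in> P" using P t(1) by simp
  then obtain j x where jx: "t = j + x" "j \<in> J" "x \<in> M"
    by (auto simp: P_def)
  have "\<exists>u\<in>J. part 0 u = u \<and> u * j - j \<in> I"
    by (rule common_left_unit[OF I J(1,2) IJ _ jx(2)]) (rule unit)
  then obtain u where u: "u \<in> J" "part 0 u = u" "u * j - j \<in> I" by blast
  have uS: "u \<in> S" using ideal_subset[OF J(1) u(1)] .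
  have "t - u * t = (x - u * x) - (u * j - j)" using jx by (simp add: algebra_simps)
  moreover have "x - u * x \<in> M" using ideal_diff[OF M'(1)] ideal_mult_left[OF M'(1)] jx uS by blast
  ultimately have "t - u * t \<in> M" using ideal_diff[OF M'(1)] u(3) M'(2) by auto
  moreover have "part m (t - u * t) = (if m = n then t - u * t else 0)" for m
    by (rule part_homogeneous) (simp add: part_diff part_mult_left[OF u(2)] t(3))
  ultimately have "t - u * t \<in> core M"
    using ideal_zero[OF M'(1)] by (auto simp: core_def)
  then have "t - u * t \<in> J" using J(3) by blast
  moreover have "u * t \<in> J" using ideal_mult_right[OF J(1) u(1) t(1)] .
  ultimately show False using ideal_diff_left_iff[OF J(1)] t(2) by blast
qed

end

text \<open>Stands for the graded simple ring \<open>S / G\<close> with a nonzero idempotent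
  \<open>v\<close> of degree 0. The quotient is not formed; its ideals appear as ideals above
  \<open>G\<close>.\<close>

locale graded_simple_corner = graded_subring +
  fixes G v
  assumes G: "is_ideal G" and graded_G: "graded G"
    and graded_simple: "\<And>J. is_ideal J \<Longrightarrow> graded J \<Longrightarrow> G \<subseteq> J \<Longrightarrow> J \<noteq> G \<Longrightarrow> J = S"
    and v_closed [simp]: "v \<in> S" and part_v: "part 0 v = v"
    and v_idem: "congr G (v * v) v" and v_notin: "v \<notin> G"
begin

text \<open>\<open>P\<close> need not be graded, but the homogeneous \<open>v\<close> lies in its
  core, which is graded and strictly larger than \<open>G\<close>.\<close>

lemma ideal_containing_v:
  assumes P: "is_ideal P" "G \<subseteq> P" "v \<in> P"
  shows "P = S"
proof -
  have "v \<in> core P"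
    using P(3) ideal_zero[OF P(1)] part_homogeneous[OF part_v] by (auto simp: core_def)
  then have "core P = S"
    using graded_simple[OF is_ideal_core[OF P(1)] graded_core[OF P(1)]]
      core_largest[OF graded_G P(2)] v_notin by blast
  then show ?thesis using core_subset[of P] ideal_subset[OF P(1)] by blast
qed

text \<open>Zorn's lemma is applied to the ideals that avoid \<open>v\<close>, a condition inherited
  by unions of chains. By \<open>ideal_containing_v\<close> the result is maximal among all proper
  ideals.\<close>

lemma exists_maximal:
  assumes P: "is_ideal P" "G \<subseteq> P" "v \<notin> P" and IG: "I \<subseteq> G"
  shows "\<exists>N. maximal_over I N \<and> P \<subseteq> N"
proof -
  let ?A = "{Q. is_ideal Q \<and> P \<subseteq> Q \<and> v \<notin> Q}"
  have "\<exists>N\<in>?A. \<forall>X\<in>?A. N \<subseteq> X \<longrightarrow> X = N"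
  proof (rule subset_Zorn_nonempty)
    show "?A \<noteq> {}" using P by blast
    fix C assume C: "C \<noteq> {}" "subset.chain ?A C"
    have ideals: "is_ideal Q" "P \<subseteq> Q" "v \<notin> Q" if "Q \<in> C" for Q
      using C(2) that by (auto simp: subset.chain_def)
    have "is_ideal (\<Union>C)"
    proof (rule is_idealI)
      show "\<Union>C \<subseteq> S" using ideals(1) ideal_subset by blast
      show "0 \<in> \<Union>C" using C(1) ideals(1) ideal_zero by blast
      fix x y assume "x \<in> \<Union>C" "y \<in> \<Union>C"
      then obtain X Y where "X \<in> C" "x \<in> X" "Y \<in> C" "y \<in> Y" by blast
      moreover have "X \<subseteq> Y \<or> Y \<subseteq> X" using C(2) calculation by (auto simp: subset.chain_def)
      ultimately obtain Z where "Z \<in> C" "x \<in> Z" "y \<in> Z" by blast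
      then show "x - y \<in> \<Union>C" using ideal_diff ideals(1) by blast
    next
      fix a x assume "x \<in> \<Union>C" "a \<in> S"
      then show "a * x \<in> \<Union>C" "x * a \<in> \<Union>C"
        using ideal_mult_left ideal_mult_right ideals(1) by blast+
    qed
    then show "\<Union>C \<in> ?A" using ideals C(1) by blast
  qed
  then obtain N where "N \<in> ?A" and max': "\<forall>X\<in>?A. N \<subseteq> X \<longrightarrow> X = N" ..
  then have N: "is_ideal N" "P \<subseteq> N" "v \<notin> N" by simp_all
  have max: "X = N" if "is_ideal X" "P \<subseteq> X" "v \<notin> X" "N \<subseteq> X" for X
    using max' that by simp
  have "maximal_over I N"
    unfolding maximal_over_def
  proof (intro conjI allI impI)
    show "is_ideal N" "N \<noteq> S" using N by auto
    show "I \<subseteq> N" using IG P(2) N(2) by blast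
    fix Q assume "is_ideal Q" "N \<subseteq> Q" "Q \<noteq> S"
    then show "Q = N"
      using max[of Q] ideal_containing_v[of Q] P(2) N(2) by blast
  qed
  then show ?thesis using N(2) by blast
qed

text \<open>The largest ideal whose corner between \<open>v\<close> and \<open>v\<close> lies in
  \<open>d\<close> times the corner, modulo \<open>G\<close>. For central \<open>d\<close> it
  contains \<open>d\<close>, so it can replace the ideal generated by \<open>d\<close>; and
  \<open>v\<close> belongs to it only if \<open>d\<close> has a right inverse in the corner.\<close>

definition principal :: "'a \<Rightarrow> 'a set" where
  "principal d =
     {y \<in> S. \<forall>p\<in>S. \<forall>q\<in>S. \<exists>r\<in>S. v * p * y * q * v - d * (v * r * v) \<in> G}"

lemma is_ideal_principal:
  assumes d: "d \<in> S"
  shows "is_ideal (principal d)"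
proof (rule is_idealI)
  show "principal d \<subseteq> S" by (auto simp: principal_def)
  show "0 \<in> principal d"
    unfolding principal_def mem_Collect_eq
    by (intro conjI ballI bexI[of _ 0]) (simp_all add: ideal_zero[OF G])
next
  fix x y assume x: "x \<in> principal d" and y: "y \<in> principal d"
  have "\<exists>r\<in>S. v * p * (x - y) * q * v - d * (v * r * v) \<in> G" if pq: "p \<in> S" "q \<in> S" for p q
  proof -
    obtain r where r: "r \<in> S" "v * p * x * q * v - d * (v * r * v) \<in> G"
      using x pq unfolding principal_def by blast
    obtain r' where r': "r' \<in> S" "v * p * y * q * v - d * (v * r' * v) \<in> G"
      using y pq unfolding principal_def by blast
    have "v * p * (x - y) * q * v - d * (v * (r - r') * v) =
        (v * p * x * q * v - d * (v * r * v)) - (v * p * y * q * v - d * (v * r' * v))"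
      by (simp add: algebra_simps)
    then show ?thesis using r r' ideal_diff[OF G] diff_closed by metis
  qed
  then show "x - y \<in> principal d" using x y by (auto simp: principal_def)
next
  fix a x assume x: "x \<in> principal d" and a: "a \<in> S"
  have "\<exists>r\<in>S. v * p * (a * x) * q * v - d * (v * r * v) \<in> G" if pq: "p \<in> S" "q \<in> S" for p q
  proof -
    have "p * a \<in> S" using pq a by simp
    then obtain r where "r \<in> S" "v * (p * a) * x * q * v - d * (v * r * v) \<in> G"
      using x pq unfolding principal_def by blast
    then show ?thesis by (auto simp: mult.assoc)
  qed
  then show "a * x \<in> principal d" using x a by (auto simp: principal_def)
  have "\<exists>r\<in>S. v * p * (x * a) * q * v - d * (v * r * v) \<in> G" if pq: "p \<in> S" "q \<in> S" for p q
  proof -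
    have "a * q \<in> S" using pq a by simp
    then obtain r where "r \<in> S" "v * p * x * (a * q) * v - d * (v * r * v) \<in> G"
      using x pq unfolding principal_def by blast
    then show ?thesis by (auto simp: mult.assoc)
  qed
  then show "x * a \<in> principal d" using x a by (auto simp: principal_def)
qed

lemma principal_superset: "G \<subseteq> principal d"
proof
  fix x assume x: "x \<in> G"
  have "v * p * x * q * v - d * (v * 0 * v) \<in> G" if "p \<in> S" "q \<in> S" for p q
    unfolding mult_zero_right mult_zero_left diff_zero
    by (intro ideal_mult_right[OF G] ideal_mult_left[OF G] x that v_closed mult_closed)
  then show "x \<in> principal d"
    using ideal_subset[OF G x] zero_closed unfolding principal_def by blast
qed

text \<open>Centrality in the corner modulo \<open>G\<close>. The absorption of \<open>v\<close> on
  the right follows from the one on the left by commuting \<open>d\<close> with \<open>v\<close>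
  itself.\<close>

definition corner_central :: "'a \<Rightarrow> bool" where
  "corner_central d \<longleftrightarrow> d \<in> S \<and> congr G (v * d) d \<and>
     (\<forall>r\<in>S. congr G (d * (v * r * v)) (v * r * v * d))"

text \<open>Inserting \<open>v\<close> in front of \<open>d\<close> completes \<open>v * p\<close>
  to the corner element \<open>v * p * v\<close>, past which \<open>d\<close> can be moved to the
  left.\<close>

lemma principal_self:
  assumes d: "corner_central d"
  shows "d \<in> principal d"
proof -
  note [trans] = congr_trans[OF G]
  have dS: "d \<in> S" using d by (simp add: corner_central_def)
  have "\<exists>r\<in>S. v * p * d * q * v - d * (v * r * v) \<in> G" if pq: "p \<in> S" "q \<in> S" for p q
  proof -
    have "congr G (v * p * d * (q * v)) (v * p * (v * d) * (q * v))"
      using d dS pq by (intro congr_mult_left[OF G] congr_mult_right[OF G])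
        (auto simp: corner_central_def intro: congr_sym[OF G])
    also have "v * p * (v * d) * (q * v) = (v * p * v * d) * (q * v)"
      by (simp add: mult.assoc)
    also have "congr G \<dots> (d * (v * p * v) * (q * v))"
      using d pq by (intro congr_mult_right[OF G])
        (auto simp: corner_central_def intro: congr_sym[OF G])
    also have "d * (v * p * v) * (q * v) = d * (v * (p * v * q) * v)"
      by (simp add: mult.assoc)
    finally have "v * p * d * q * v - d * (v * (p * v * q) * v) \<in> G"
      by (simp add: congr_def mult.assoc)
    moreover have "p * v * q \<in> S" using pq by simp
    ultimately show ?thesis by blast
  qed
  then show ?thesis using dS by (auto simp: principal_def)
qed

text \<open>The defining condition is additive in \<open>p\<close> and in \<open>q\<close>, so
  homogeneous \<open>p\<close> and \<open>q\<close> suffice. For these, taking one part of the whole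
  relation isolates \<open>part n y\<close> and replaces \<open>r\<close> by one of its
  parts.\<close>

lemma graded_principal:
  assumes d: "d \<in> S" "part i d = d"
  shows "graded (principal d)"
  unfolding graded_def
proof (intro ballI allI)
  fix y n assume y: "y \<in> principal d"
  define Q where "Q b \<longleftrightarrow> (\<exists>r\<in>S. b - d * (v * r * v) \<in> G)" for b
  have Q0: "Q 0" unfolding Q_def by (intro bexI[of _ 0]) (simp_all add: ideal_zero[OF G])
  have Qadd: "Q (a + b)" if "Q a" "Q b" for a b
  proof -
    obtain r r' where "r \<in> S" "r' \<in> S" "a - d * (v * r * v) \<in> G" "b - d * (v * r' * v) \<in> G"
      using \<open>Q a\<close> \<open>Q b\<close> by (auto simp: Q_def)
    then have "(a - d * (v * r * v)) + (b - d * (v * r' * v)) \<in> G" "r + r' \<in> S"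
      using ideal_add[OF G] by auto
    moreover have "(a - d * (v * r * v)) + (b - d * (v * r' * v)) =
        a + b - d * (v * (r + r') * v)"
      by (simp add: algebra_simps)
    ultimately show ?thesis by (auto simp: Q_def)
  qed
  have yS: "y \<in> S" using y by (simp add: principal_def)
  have "Q (v * p * part n y * q * v)" if pS: "p \<in> S" and qS: "q \<in> S" for p q
    using pS qS
  proof (induction arbitrary: q rule: homogeneous_induct)
    case (part a q)
    note q = part
    from q show ?case
    proof (induction rule: homogeneous_induct)
      case (part b)
      let ?p = "part a p" and ?q = "part b q"
      have h: "part a (v * ?p) = v * ?p" "part b (?q * v) = ?q * v"
        using part_mult_homogeneous[OF part_v, of a ?p] part_mult_homogeneous[OF _ part_v, of b ?q]
        by (simp_all add: part_part)
      obtain r where r: "r \<in> S" "v * ?p * y * ?q * v - d * (v * r * v) \<in> G"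
        using y part_closed[OF pS, of a] part_closed[OF q, of b] unfolding principal_def by blast
      have "part (a + n + b) (v * ?p * y * ?q * v - d * (v * r * v)) \<in> G"
        using r graded_G by (auto simp: graded_def)
      also have "part (a + n + b) (v * ?p * y * ?q * v - d * (v * r * v)) =
          part (a + n + b) (v * ?p * (y * (?q * v))) - part (a + n + b) (d * (v * r * v))"
        by (simp add: part_diff mult.assoc)
      also have "part (a + n + b) (v * ?p * (y * (?q * v))) = v * ?p * part n y * ?q * v"
        unfolding part_mult_left[OF h(1)] part_mult_right[OF h(2)] by (simp add: mult.assoc)
      also have "part (a + n + b) (d * (v * r * v)) = d * (v * part (a + n + b - i) r * v)"
        by (simp add: part_mult_left[OF d(2)] part_mult_left[OF part_v] part_mult_right[OF part_v])
      finally show ?case using r(1) by (auto simp: Q_def)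
    next
      case zero
      then show ?case using Q0 by simp
    next
      case (add a b)
      then show ?case using Qadd by (simp add: distrib_left distrib_right)
    qed
  next
    case zero
    then show ?case using Q0 by simp
  next
    case (add a b q)
    then show ?case using Qadd[OF add(3)[OF add(5)] add(4)[OF add(5)]] by (simp add: distrib_left distrib_right)
  qed
  then show "part n y \<in> principal d" using yS by (auto simp: principal_def Q_def)
qed

end

section \<open>Supports and leading coefficients modulo an ideal\<close>

context graded_subring
begin

definition support :: "'a set \<Rightarrow> 'a \<Rightarrow> int set" where
  "support I x = {n. part n x \<notin> I}"

lemma finite_support: "is_ideal I \<Longrightarrow> finite (support I x)"
  using finite_parts[of x] ideal_zero unfolding support_def
  by (metis (mono_tags, lifting) finite_subset mem_Collect_eq subsetI)

lemma support_empty: "is_ideal I \<Longrightarrow> support I x = {} \<Longrightarrow> x \<in> I"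
  using ideal_of_parts unfolding support_def by blast

lemma support_diff: "is_ideal I \<Longrightarrow> support I (x - y) \<subseteq> support I x \<union> support I y"
  by (auto simp: support_def part_diff intro: ideal_diff)

lemma support_mult_left:
  assumes "is_ideal I" "a \<in> S" "part i a = a"
  shows "support I (a * x) \<subseteq> (\<lambda>n. n + i) ` support I x"
proof
  fix n assume "n \<in> support I (a * x)"
  then have "n - i \<in> support I x"
    using assms ideal_mult_left by (auto simp: support_def part_mult_left)
  then show "n \<in> (\<lambda>n. n + i) ` support I x" by force
qed

lemma support_mult_right:
  assumes "is_ideal I" "a \<in> S" "part i a = a"
  shows "support I (x * a) \<subseteq> (\<lambda>n. n + i) ` support I x"
proof
  fix n assume "n \<in> support I (x * a)"
  then have "n - i \<in> support I x"
    using assms ideal_mult_right by (auto simp: support_def part_mult_right)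
  then show "n \<in> (\<lambda>n. n + i) ` support I x" by force
qed

text \<open>Used at the extremal degrees of a product, where a single pair of parts can contribute
  modulo \<open>I\<close>.\<close>

lemma part_mult_single:
  assumes I: "is_ideal I" and x: "x \<in> S" and y: "y \<in> S"
    and other: "\<And>m. m \<noteq> k \<Longrightarrow> part m x \<in> I \<or> part (n - m) y \<in> I"
  shows "part n (x * y) - part k x * part (n - k) y \<in> I"
proof -
  let ?N = "{m. part m x \<noteq> 0}"
  have "part n (x * y) = (\<Sum>m\<in>?N. part n (part m x * y))"
    by (subst sum_parts[of x, symmetric]) (simp add: sum_distrib_right part_sum)
  also have "\<dots> = (\<Sum>m\<in>?N. part m x * part (n - m) y)"
    by (rule sum.cong[OF refl]) (simp add: part_mult_left part_part)
  also have "\<dots> = part k x * part (n - k) y + (\<Sum>m\<in>?N - {k}. part m x * part (n - m) y)"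
    using finite_parts[of x] by (cases "k \<in> ?N") (auto simp: sum.remove)
  finally have "part n (x * y) - part k x * part (n - k) y =
      (\<Sum>m\<in>?N - {k}. part m x * part (n - m) y)"
    by simp
  also have "\<dots> \<in> I"
    using other x y ideal_mult_left[OF I] ideal_mult_right[OF I]
    by (intro ideal_sum[OF I]) (metis DiffD2 insertI1 part_closed)
  finally show ?thesis .
qed

text \<open>The analogue of an ideal of leading coefficients, \<open>m\<close> being the marked position in \<open>\<Lambda>\<close>.\<close>

definition leading :: "'a set \<Rightarrow> 'a set \<Rightarrow> int set \<Rightarrow> int \<Rightarrow> 'a set" where
  "leading I M \<Lambda> m =
     {y \<in> S. \<forall>k. \<exists>z\<in>M. support I z \<subseteq> (\<lambda>l. l - m + k) ` \<Lambda> \<and> part k z - part k y \<in> I}"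

text \<open>Every degree \<open>k\<close> has its own witness \<open>z\<close>, which makes the set
  graded: for \<open>part n y\<close> the witness of \<open>y\<close> serves in degree
  \<open>n\<close> and 0 serves elsewhere. Witnesses for the same \<open>k\<close> have support in
  the same translate of \<open>\<Lambda>\<close>, so differences keep that bound.\<close>

lemma
  assumes I: "is_ideal I" "graded I" and M: "is_ideal M" "I \<subseteq> M"
  shows is_ideal_leading: "is_ideal (leading I M \<Lambda> m)"
    and graded_leading: "graded (leading I M \<Lambda> m)"
    and leading_superset: "I \<subseteq> leading I M \<Lambda> m"
proof -
  have sub: "x - y \<in> leading I M \<Lambda> m"
    if x: "x \<in> leading I M \<Lambda> m" and y: "y \<in> leading I M \<Lambda> m" for x y
  proof -
    have "\<exists>z\<in>M. support I z \<subseteq> (\<lambda>l. l - m + k) ` \<Lambda> \<and> part k z - part k (x - y) \<in> I" for k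
    proof -
      obtain a where a: "a \<in> M" "support I a \<subseteq> (\<lambda>l. l - m + k) ` \<Lambda>" "part k a - part k x \<in> I"
        using x unfolding leading_def by blast
      obtain b where b: "b \<in> M" "support I b \<subseteq> (\<lambda>l. l - m + k) ` \<Lambda>" "part k b - part k y \<in> I"
        using y unfolding leading_def by blast
      have "part k (a - b) - part k (x - y) = (part k a - part k x) - (part k b - part k y)"
        by (simp add: part_diff)
      then have "part k (a - b) - part k (x - y) \<in> I"
        using ideal_diff[OF I(1) a(3) b(3)] by simp
      moreover have "support I (a - b) \<subseteq> (\<lambda>l. l - m + k) ` \<Lambda>"
        using support_diff[OF I(1), of a b] a(2) b(2) by blast
      ultimately show ?thesis using ideal_diff[OF M(1) a(1) b(1)] by blast
    qed
    then show ?thesis using x y by (simp add: leading_def)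
  qed
  have zero: "0 \<in> leading I M \<Lambda> m"
    unfolding leading_def mem_Collect_eq
    by (intro conjI allI bexI[of _ 0])
      (simp_all add: ideal_zero[OF M(1)] ideal_zero[OF I(1)] support_def)
  have add: "x + y \<in> leading I M \<Lambda> m"
    if "x \<in> leading I M \<Lambda> m" "y \<in> leading I M \<Lambda> m" for x y
    using sub[OF that(1) sub[OF zero that(2)]] by simp
  have mult: "a * x \<in> leading I M \<Lambda> m \<and> x * a \<in> leading I M \<Lambda> m"
    if x: "x \<in> leading I M \<Lambda> m" and aS: "a \<in> S" for a x
    using aS
  proof (induction rule: homogeneous_induct)
    case (part i)
    let ?a = "part i a"
    have a: "?a \<in> S" "part i ?a = ?a" using aS by (auto simp: part_part)
    have "\<exists>z\<in>M. support I z \<subseteq> (\<lambda>l. l - m + k) ` \<Lambda> \<and> part k z - part k (?a * x) \<in> I"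
      "\<exists>z\<in>M. support I z \<subseteq> (\<lambda>l. l - m + k) ` \<Lambda> \<and> part k z - part k (x * ?a) \<in> I" for k
    proof -
      \<comment> \<open>A witness for degree \<open>k - i\<close>; multiplication by an element of
        degree \<open>i\<close> moves its marked position to \<open>k\<close>.\<close>
      obtain z where z: "z \<in> M" "support I z \<subseteq> (\<lambda>l. l - m + (k - i)) ` \<Lambda>"
        "part (k - i) z - part (k - i) x \<in> I"
        using x unfolding leading_def by blast
      have "(\<lambda>n. n + i) ` support I z \<subseteq> (\<lambda>l. l - m + k) ` \<Lambda>" using z(2) by force
      then have "support I (?a * z) \<subseteq> (\<lambda>l. l - m + k) ` \<Lambda>" "support I (z * ?a) \<subseteq> (\<lambda>l. l - m + k) ` \<Lambda>"
        using support_mult_left[OF I(1) a, of z] support_mult_right[OF I(1) a, of z] by auto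
      moreover have "part k (?a * z) - part k (?a * x) \<in> I"
        using ideal_mult_left[OF I(1) z(3) a(1)]
        by (simp add: part_mult_left[OF a(2)] right_diff_distrib)
      moreover have "part k (z * ?a) - part k (x * ?a) \<in> I"
        using ideal_mult_right[OF I(1) z(3) a(1)]
        by (simp add: part_mult_right[OF a(2)] left_diff_distrib)
      moreover have "?a * z \<in> M" "z * ?a \<in> M"
        using ideal_mult_left[OF M(1) z(1) a(1)] ideal_mult_right[OF M(1) z(1) a(1)] .
      ultimately show
        "\<exists>z\<in>M. support I z \<subseteq> (\<lambda>l. l - m + k) ` \<Lambda> \<and> part k z - part k (?a * x) \<in> I"
        "\<exists>z\<in>M. support I z \<subseteq> (\<lambda>l. l - m + k) ` \<Lambda> \<and> part k z - part k (x * ?a) \<in> I"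
        by blast+
    qed
    then show ?case using x a by (auto simp: leading_def)
  next
    case zero
    then show ?case using \<open>0 \<in> leading I M \<Lambda> m\<close> by simp
  next
    case (add a b)
    then show ?case using \<open>\<And>x y. x \<in> leading I M \<Lambda> m \<Longrightarrow> y \<in> leading I M \<Lambda> m \<Longrightarrow> x + y \<in> leading I M \<Lambda> m\<close>
      by (simp add: distrib_left distrib_right)
  qed
  show "is_ideal (leading I M \<Lambda> m)"
    by (rule is_idealI) (use sub zero mult in \<open>auto simp: leading_def\<close>)
  show "graded (leading I M \<Lambda> m)"
    unfolding graded_def
  proof (intro ballI allI)
    fix x n assume x: "x \<in> leading I M \<Lambda> m"
    have "\<exists>z\<in>M. support I z \<subseteq> (\<lambda>l. l - m + k) ` \<Lambda> \<and> part k z - part k (part n x) \<in> I" for k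
    proof (cases "k = n")
      case True
      then show ?thesis using x by (auto simp: leading_def part_part)
    next
      case False
      then show ?thesis
        by (intro bexI[of _ 0])
          (simp_all add: part_part support_def ideal_zero[OF M(1)] ideal_zero[OF I(1)])
    qed
    then show "part n x \<in> leading I M \<Lambda> m" using x by (auto simp: leading_def)
  qed
  show "I \<subseteq> leading I M \<Lambda> m"
  proof
    fix x assume x: "x \<in> I"
    have "\<exists>z\<in>M. support I z \<subseteq> (\<lambda>l. l - m + k) ` \<Lambda> \<and> part k z - part k x \<in> I" for k
      using ideal_zero[OF M(1)] ideal_zero[OF I(1)] ideal_uminus[OF I(1)] I(2) x
      by (intro bexI[of _ 0]) (auto simp: support_def graded_def)
    then show "x \<in> leading I M \<Lambda> m" using ideal_subset[OF I(1) x] by (simp add: leading_def)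
  qed
qed

end

section \<open>Degree comparison and the central unit\<close>

context graded_simple_corner
begin

lemma part_mult_v:
  "part n (v * x) = v * part n x" "part n (x * v) = part n x * v"
  by (simp_all add: part_mult_left[OF part_v] part_mult_right[OF part_v])

lemma v_cancel: "x \<in> S \<Longrightarrow> congr G (v * (v * x)) (v * x)" "x \<in> S \<Longrightarrow> congr G (x * v * v) (x * v)"
  using congr_mult_right[OF G v_idem, of x] congr_mult_left[OF G v_idem, of x]
  by (simp_all add: mult.assoc)

text \<open>Five factors arise when membership of \<open>v\<close> in \<open>principal d\<close> is
  tested at \<open>p = q = v\<close>.\<close>

lemma v_power: "congr G (v * v * v * v * v) v"
proof -
  note [trans] = congr_trans[OF G]
  have "congr G (v * v * v * v * v) (v * v * v * v)"
    using v_cancel(2)[of "v * v * v"] by simp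
  also have "congr G (v * v * v * v) (v * v * v)"
    using v_cancel(2)[of "v * v"] by simp
  also have "congr G (v * v * v) (v * v)"
    using v_cancel(2)[of v] by simp
  also have "congr G (v * v) v" by (rule v_idem)
  finally show ?thesis .
qed

text \<open>The lowest and the highest component of \<open>d b\<close> are those of \<open>b\<close>, multiplied by the extremal
  components of \<open>d\<close>; so \<open>d b\<close> is not homogeneous, hence not \<open>v\<close>.\<close>

lemma v_notin_principal:
  assumes d: "d \<in> S" and k: "k \<noteq> 0" and d0: "part 0 d - v \<in> G"
    and supp: "support G d \<subseteq> {min 0 k..max 0 k}"
    and t: "t \<in> S" "t * part k d - v \<in> G"
  shows "v \<notin> principal d"
proof
  note [trans] = congr_trans[OF G]
  assume "v \<in> principal d"
  \<comment> \<open>Testing at \<open>p = q = v\<close> yields a corner element \<open>b\<close>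
    with \<open>d * b\<close> congruent to \<open>v\<close>.\<close>
  then obtain r where r: "r \<in> S" "v * v * v * v * v - d * (v * r * v) \<in> G"
    using v_closed unfolding principal_def by blast
  define b where "b = v * r * v"
  have b: "b \<in> S" using r by (simp add: b_def)
  have "congr G v (v * v * v * v * v)" using congr_sym[OF G v_power] .
  also have "congr G \<dots> (d * b)" using r d b by (simp add: congr_def b_def)
  finally have vdb: "congr G v (d * b)" .
  have vb: "congr G (v * part n b) (part n b)" for n
    using v_cancel(1)[of "part n r * v"] r by (simp add: b_def part_mult_v mult.assoc)
  have deg: "part n (d * b) \<in> G" if "n \<noteq> 0" for n
  proof -
    have "congr G 0 (part n (d * b))"
      using congr_part[OF G graded_G vdb, of n] part_homogeneous[OF part_v, of n] that by simp
    then show ?thesis using congr_sym[OF G] congr_zero_iff[OF G] by blast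
  qed
  \<comment> \<open>If \<open>part 0 d\<close> alone contributes to degree \<open>n\<close> of
    \<open>d * b\<close>, it acts there as \<open>v\<close>, so \<open>part n b\<close> vanishes
    unless \<open>n = 0\<close>. In \<open>hi\<close> the part of degree \<open>k\<close> plays this
    role and is cancelled by \<open>t\<close>. The names fit the case \<open>k > 0\<close>.\<close>
  have lo: "part n b \<in> G"
    if "n \<noteq> 0" "\<And>m. m \<noteq> 0 \<Longrightarrow> part m d \<in> G \<or> part (n - m) b \<in> G" for n
  proof -
    have "part n (d * b) - part 0 d * part n b \<in> G"
      using part_mult_single[OF G d b, of 0 n] that(2) by simp
    then have "part 0 d * part n b \<in> G"
      using ideal_diff_left_iff[OF G] deg[OF that(1)] by blast
    moreover have "congr G (part 0 d * part n b) (v * part n b)"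
      using d0 d b by (intro congr_mult_right[OF G]) (auto simp: congr_def)
    ultimately show ?thesis using vb[of n] congr_mem_iff[OF G G order_refl] by blast
  qed
  have hi: "part n b \<in> G"
    if "n + k \<noteq> 0" "\<And>m. m \<noteq> k \<Longrightarrow> part m d \<in> G \<or> part (n + k - m) b \<in> G" for n
  proof -
    have "part (n + k) (d * b) - part k d * part n b \<in> G"
      using part_mult_single[OF G d b, of k "n + k"] that(2) by simp
    then have "part k d * part n b \<in> G"
      using ideal_diff_left_iff[OF G] deg[OF that(1)] by blast
    then have "t * (part k d * part n b) \<in> G" using ideal_mult_left[OF G] t(1) by blast
    then have "(t * part k d) * part n b \<in> G" by (simp add: mult.assoc)
    moreover have "congr G ((t * part k d) * part n b) (v * part n b)"
      using t d b by (intro congr_mult_right[OF G]) (auto simp: congr_def)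
    ultimately show ?thesis using vb[of n] congr_mem_iff[OF G G order_refl] by blast
  qed
  have "support G b \<noteq> {}"
  proof
    assume "support G b = {}"
    then have "d * b \<in> G" using support_empty[OF G] ideal_mult_left[OF G] d by blast
    then show False using vdb v_notin congr_mem_iff[OF G G order_refl] by blast
  qed
  moreover note fin = finite_support[OF G, of b]
  ultimately have Min: "part (Min (support G b)) b \<notin> G" and Max: "part (Max (support G b)) b \<notin> G"
    and le: "Min (support G b) \<le> Max (support G b)"
    using Min_in[of "support G b"] Max_in[of "support G b"]
    by (simp_all add: support_def)
  have below: "part n b \<in> G" if "n < Min (support G b)" for n
    using that Min_le[OF fin, of n] by (force simp: support_def)
  have above: "part n b \<in> G" if "n > Max (support G b)" for n
    using that Max_ge[OF fin, of n] by (force simp: support_def)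
  have dout: "part n d \<in> G" if "n \<notin> {min 0 k..max 0 k}" for n
    using that supp by (auto simp: support_def)
  let ?lo = "Min (support G b)" and ?hi = "Max (support G b)"
  \<comment> \<open>For \<open>k > 0\<close> the lowest degree of \<open>b\<close> must be 0 and the
    highest \<open>- k\<close>, which is smaller. For \<open>k < 0\<close> the two ends exchange
    their roles.\<close>
  show False
  proof (cases "k > 0")
    case True
    have *: "part m d \<in> G \<or> part (?lo - m) b \<in> G" if "m \<noteq> 0" for m
    proof (cases "m > 0")
      case True
      then show ?thesis using below[of "?lo - m"] by simp
    next
      case False
      then show ?thesis using dout[of m] that \<open>k > 0\<close> by simp
    qed
    have lo0: "?lo = 0" using lo[OF _ *] Min by blast
    have *: "part m d \<in> G \<or> part (?hi + k - m) b \<in> G" if "m \<noteq> k" for m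
    proof (cases "m < k")
      case True
      then show ?thesis using above[of "?hi + k - m"] by simp
    next
      case False
      then show ?thesis using dout[of m] that \<open>k > 0\<close> by simp
    qed
    have "?hi + k = 0" using hi[OF _ *] Max by blast
    then show False using lo0 le True by linarith
  next
    case False
    then have k': "k < 0" using k by simp
    have *: "part m d \<in> G \<or> part (?hi - m) b \<in> G" if "m \<noteq> 0" for m
    proof (cases "m < 0")
      case True
      then show ?thesis using above[of "?hi - m"] by simp
    next
      case False
      then show ?thesis using dout[of m] that k' by simp
    qed
    have hi0: "?hi = 0" using lo[OF _ *] Max by blast
    have *: "part m d \<in> G \<or> part (?lo + k - m) b \<in> G" if "m \<noteq> k" for m
    proof (cases "m > k")
      case True
      then show ?thesis using below[of "?lo + k - m"] by simp
    next
      case False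
      then show ?thesis using dout[of m] that k' by simp
    qed
    have "?lo + k = 0" using hi[OF _ *] Min by blast
    then show False using hi0 le k' by linarith
  qed
qed

text \<open>Normalising an element of \<open>M\<close> of minimal support so that one component is \<open>v\<close>, its commutators
  with homogeneous elements have smaller support and so vanish modulo \<open>G\<close>. Hence the other components
  are central, and graded simplicity makes them invertible.\<close>

lemma exists_central_unit:
  assumes M: "is_ideal M" "G \<subseteq> M" "M \<noteq> G" "v \<notin> M"
  shows "\<exists>c c' i. i \<noteq> 0 \<and> corner_central c \<and> part i c = c \<and> c' \<in> S \<and> congr G (c' * c) v"
proof -
  note [trans] = congr_trans[OF G]
  obtain x0 where x0: "x0 \<in> M - G" using M(2,3) by blast
  obtain x where x: "x \<in> M" "x \<notin> G"
    and least: "\<And>y. y \<in> M \<Longrightarrow> y \<notin> G \<Longrightarrow> card (support G x) \<le> card (support G y)"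
    using ex_has_least_nat[of "\<lambda>x. x \<in> M - G" x0 "\<lambda>x. card (support G x)"] x0 by auto
  have xS: "x \<in> S" using ideal_subset[OF M(1) x(1)] .
  define \<Lambda> where "\<Lambda> = support G x"
  have fin\<Lambda>: "finite \<Lambda>" unfolding \<Lambda>_def by (rule finite_support[OF G])
  have "\<Lambda> \<noteq> {}" using support_empty[OF G] x(2) by (auto simp: \<Lambda>_def)
  then obtain m where m: "m \<in> \<Lambda>" by blast
  \<comment> \<open>Graded simplicity takes the place of dividing by a leading coefficient:
    \<open>D\<close> contains \<open>part m x\<close>, which is not in \<open>G\<close>, so
    \<open>D\<close> is everything and \<open>v\<close> is realised in degree 0 by some
    \<open>z\<close> in \<open>M\<close>.\<close>
  define D where "D = leading G M \<Lambda> m"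
  have D: "is_ideal D" "graded D" "G \<subseteq> D"
    unfolding D_def
    by (rule is_ideal_leading[OF G graded_G M(1,2)] graded_leading[OF G graded_G M(1,2)]
        leading_superset[OF G graded_G M(1,2)])+
  have "\<exists>z\<in>M. support G z \<subseteq> (\<lambda>l. l - m + k) ` \<Lambda> \<and> part k z - part k (part m x) \<in> G" for k
  proof (cases "k = m")
    case True
    then show ?thesis using x(1) ideal_zero[OF G]
      by (intro bexI[of _ x]) (auto simp: \<Lambda>_def part_part)
  next
    case False
    then show ?thesis
      by (intro bexI[of _ 0])
        (simp_all add: part_part support_def ideal_zero[OF M(1)] ideal_zero[OF G])
  qed
  then have "part m x \<in> D" using xS by (simp add: D_def leading_def)
  moreover have "part m x \<notin> G" using m by (simp add: \<Lambda>_def support_def)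
  ultimately have "D = S" using graded_simple[OF D] by blast
  then have "v \<in> D" by simp
  then obtain z where z: "z \<in> M" "support G z \<subseteq> (\<lambda>l. l - m + 0) ` \<Lambda>" "part 0 z - part 0 v \<in> G"
    unfolding D_def leading_def by blast
  have zS: "z \<in> S" using ideal_subset[OF M(1) z(1)] .
  define y where "y = v * z * v"
  have yM: "y \<in> M"
    unfolding y_def by (intro ideal_mult_left[OF M(1)] ideal_mult_right[OF M(1)] z v_closed)
  have yS: "y \<in> S" using ideal_subset[OF M(1) yM] .
  have part_y: "part n y = v * part n z * v" for n by (simp add: y_def part_mult_v)
  have vy: "congr G (v * part n y) (part n y)" for n
    using v_cancel(1)[of "part n z * v"] zS by (simp add: part_y mult.assoc)
  have "congr G (part 0 z) v" using z(3) zS part_v by (simp add: congr_def)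
  then have "congr G (part 0 y) (v * v * v)"
    unfolding part_y by (intro congr_mult_left[OF G] congr_mult_right[OF G]) auto
  also have "congr G (v * v * v) (v * v)" using v_cancel(2)[of v] by simp
  also have "congr G (v * v) v" by (rule v_idem)
  finally have y0: "congr G (part 0 y) v" .
  have comm: "part n y * (v * r * v) - v * r * v * part n y \<in> G" if "r \<in> S" for r n
    using that
  proof (induction rule: homogeneous_induct)
    case (part d)
    define a where "a = v * part d r * v"
    have a: "a \<in> S" "part d a = a" using that by (simp_all add: a_def part_mult_v part_part)
    define w where "w = y * a - a * y"
    have part_w: "part n w = part (n - d) y * a - a * part (n - d) y" for n
      by (simp add: w_def part_diff part_mult_left[OF a(2)] part_mult_right[OF a(2)])
    have wM: "w \<in> M"
      unfolding w_def
      by (intro ideal_diff[OF M(1)] ideal_mult_left[OF M(1)] ideal_mult_right[OF M(1)] yM a)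
    \<comment> \<open>The commutator has its support in the shifted support of \<open>z\<close>, and
      the position coming from degree 0 drops out, because \<open>part 0 y\<close> acts as
      \<open>v\<close> on both sides of \<open>a\<close>.\<close>
    have "support G w \<subseteq> (\<lambda>n. n + d) ` ((\<lambda>l. l - m) ` \<Lambda> - {0})"
    proof
      fix n assume n: "n \<in> support G w"
      have "n - d \<in> (\<lambda>l. l - m) ` \<Lambda>"
      proof (rule ccontr)
        assume "n - d \<notin> (\<lambda>l. l - m) ` \<Lambda>"
        then have "part (n - d) z \<in> G" using z(2) by (auto simp: support_def)
        then have "part (n - d) y \<in> G"
          unfolding part_y by (intro ideal_mult_left[OF G] ideal_mult_right[OF G] v_closed)
        then have "part n w \<in> G"
          unfolding part_w
          by (intro ideal_diff[OF G] ideal_mult_left[OF G] ideal_mult_right[OF G] a)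
        then show False using n by (simp add: support_def)
      qed
      moreover have "n - d \<noteq> 0"
      proof
        assume nd: "n - d = 0"
        have "congr G (part 0 y * a) (v * a)" by (rule congr_mult_right[OF G y0 a(1)])
        also have "congr G (v * a) a"
          using v_cancel(1)[of "part d r * v"] that by (simp add: a_def mult.assoc)
        also have "congr G a (a * v)"
          using congr_sym[OF G v_cancel(2)[of "v * part d r"]] that by (simp add: a_def)
        also have "congr G (a * v) (a * part 0 y)"
          by (rule congr_mult_left[OF G congr_sym[OF G y0] a(1)])
        finally have "part n w \<in> G" by (simp add: part_w nd congr_def)
        then show False using n by (simp add: support_def)
      qed
      ultimately show "n \<in> (\<lambda>n. n + d) ` ((\<lambda>l. l - m) ` \<Lambda> - {0})" by force
    qed
    then have "card (support G w) \<le> card ((\<lambda>l. l - m) ` \<Lambda> - {0})"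
      using fin\<Lambda> by (meson card_image_le card_mono finite_Diff finite_imageI le_trans)
    also have "\<dots> < card ((\<lambda>l. l - m) ` \<Lambda>)"
      using fin\<Lambda> m by (intro psubset_card_mono) (auto intro!: rev_image_eqI[of m])
    also have "\<dots> \<le> card \<Lambda>" by (rule card_image_le[OF fin\<Lambda>])
    finally have "w \<in> G" using least[OF wM] by (force simp: \<Lambda>_def)
    then have "part (n + d) w \<in> G" using graded_G by (simp add: graded_def)
    then show ?case by (simp add: part_w) (simp add: a_def mult.assoc)
  next
    case zero
    then show ?case using ideal_zero[OF G] by simp
  next
    case (add a b)
    have "part n y * (v * (a + b) * v) - v * (a + b) * v * part n y =
        (part n y * (v * a * v) - v * a * v * part n y) +
        (part n y * (v * b * v) - v * b * v * part n y)"
      by (simp add: algebra_simps)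
    then show ?case using ideal_add[OF G add(3,4)] by (simp only:)
  qed
  \<comment> \<open>Otherwise \<open>y\<close> is congruent to its degree-0 part, hence to
    \<open>v\<close>, and \<open>v\<close> would lie in \<open>M\<close>.\<close>
  have "\<exists>i. i \<noteq> 0 \<and> part i y \<notin> G"
  proof (rule ccontr)
    assume "\<not> ?thesis"
    then have "part n (y - part 0 y) \<in> G" for n
      using ideal_zero[OF G] by (auto simp: part_diff part_part)
    then have "y - part 0 y \<in> M" using ideal_of_parts[OF G] M(2) by blast
    then have "part 0 y \<in> M" using ideal_diff_left_iff[OF M(1)] yM by blast
    then show False using congr_mem_iff[OF G M(1,2) y0] M(4) by blast
  qed
  then obtain i where i: "i \<noteq> 0" "part i y \<notin> G" by blast
  define c where "c = part i y"
  have c: "c \<in> S" "part i c = c" using yS by (simp_all add: c_def part_part)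
  have central: "corner_central c"
    using vy[of i] comm[of _ i] c(1) by (auto simp: corner_central_def c_def congr_def)
  have "c \<in> principal c" by (rule principal_self[OF central])
  then have "principal c = S"
    using graded_simple[OF is_ideal_principal graded_principal principal_superset] c i(2)
    unfolding c_def by blast
  then have "v \<in> principal c" by simp
  then obtain r where r: "r \<in> S" "v * v * v * v * v - c * (v * r * v) \<in> G"
    using v_closed unfolding principal_def by blast
  \<comment> \<open>In the congruence of \<open>v\<close> and \<open>c * (v * r * v)\<close>, degree
    0 involves only this part of \<open>r\<close>.\<close>
  define c' where "c' = v * part (- i) r * v"
  have "congr G (v * v * v * v * v) (c * (v * r * v))" using r c by (simp add: congr_def)
  then have "congr G v (c * (v * r * v))"
    using congr_trans[OF G congr_sym[OF G v_power]] by blast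
  then have "congr G (part 0 v) (part 0 (c * (v * r * v)))" by (rule congr_part[OF G graded_G])
  also have "part 0 (c * (v * r * v)) = c * c'"
    by (simp add: part_mult_left[OF c(2)] part_mult_v c'_def)
  also have "congr G (c * c') (c' * c)"
    using central part_closed[OF r(1), of "- i"] by (auto simp: corner_central_def c'_def)
  finally have "congr G (c' * c) v" using congr_sym[OF G] part_v by simp
  moreover have "c' \<in> S" using r by (simp add: c'_def)
  ultimately show ?thesis using i(1) central c(2) by blast
qed

lemma corner_central_v: "corner_central v"
  unfolding corner_central_def
proof (intro conjI ballI)
  fix r assume r: "r \<in> S"
  have "congr G (v * (v * (r * v))) (v * (r * v))" using v_cancel(1)[of "r * v"] r by simp
  moreover have "congr G (v * r * v * v) (v * r * v)" using v_cancel(2)[of "v * r"] r by simp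
  ultimately show "congr G (v * (v * r * v)) (v * r * v * v)"
    using congr_trans[OF G] congr_sym[OF G] by (metis mult.assoc)
qed (auto intro: v_idem)

lemma corner_central_add:
  assumes "corner_central a" "corner_central b"
  shows "corner_central (a + b)"
  using assms congr_add[OF G] unfolding corner_central_def
  by (auto simp: distrib_left distrib_right)

lemma corner_central_mult:
  assumes a: "corner_central a" and b: "corner_central b"
  shows "corner_central (a * b)"
  unfolding corner_central_def
proof (intro conjI ballI)
  note [trans] = congr_trans[OF G]
  have S: "a \<in> S" "b \<in> S" using a b by (simp_all add: corner_central_def)
  then show "a * b \<in> S" by simp
  have "congr G (v * a * b) (a * b)"
    using a S by (intro congr_mult_right[OF G]) (auto simp: corner_central_def)
  then show "congr G (v * (a * b)) (a * b)" by (simp add: mult.assoc)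
  fix r assume r: "r \<in> S"
  have "congr G (a * (b * (v * r * v))) (a * (v * r * v * b))"
    using b S r by (intro congr_mult_left[OF G]) (auto simp: corner_central_def)
  also have "a * (v * r * v * b) = (a * (v * r * v)) * b" by (simp add: mult.assoc)
  also have "congr G \<dots> ((v * r * v * a) * b)"
    using a S r by (intro congr_mult_right[OF G]) (auto simp: corner_central_def)
  finally show "congr G (a * b * (v * r * v)) (v * r * v * (a * b))" by (simp add: mult.assoc)
qed

end

section \<open>A unique maximal ideal is graded\<close>

context graded_subring
begin

theorem unique_maximal_graded:
  assumes I: "is_ideal I" "graded I"
    and unit: "\<And>J x n. is_ideal J \<Longrightarrow> graded J \<Longrightarrow> I \<subseteq> J \<Longrightarrow> x \<in> J \<Longrightarrow> part n x = x \<Longrightarrow>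
      \<exists>u\<in>J. u * x - x \<in> I"
    and idem: "\<And>P. is_ideal P \<Longrightarrow> I \<subseteq> P \<Longrightarrow> P \<noteq> S \<Longrightarrow>
      \<exists>v\<in>S. part 0 v = v \<and> v * v - v \<in> I \<and> v \<notin> P"
    and M: "maximal_over I M"
    and unique: "\<And>N. maximal_over I N \<Longrightarrow> N = M"
  shows "graded M"
proof (rule ccontr)
  assume "\<not> graded M"
  define G where "G = core M"
  have M': "is_ideal M" "I \<subseteq> M" "M \<noteq> S" using M by (auto simp: maximal_over_def)
  have core: "is_ideal G" "graded G" "G \<subseteq> M" "I \<subseteq> G"
    unfolding G_def
    by (rule is_ideal_core[OF M'(1)] graded_core[OF M'(1)] core_subset core_largest[OF I(2) M'(2)])+
  have "M \<noteq> G" using \<open>\<not> graded M\<close> core(2) by blast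
  obtain v where v: "v \<in> S" "part 0 v = v" "v * v - v \<in> I" "v \<notin> M" using idem[OF M'] by blast
  interpret graded_simple_corner S part G v
  proof unfold_locales
    show "J = S" if "is_ideal J" "graded J" "G \<subseteq> J" "J \<noteq> G" for J
      using core_maximal_graded[OF I M that(1,2)] that unit[OF that(1,2)] core(4)
      unfolding G_def by blast
    show "congr G (v * v) v" using v core(4) by (auto simp: congr_def)
    show "v \<notin> G" using v(4) core(3) by blast
  qed (use core v in auto)
  obtain c c' i where c: "i \<noteq> 0" "corner_central c" "part i c = c" "c' \<in> S" "congr G (c' * c) v"
    using exists_central_unit[OF M'(1) core(3) \<open>M \<noteq> G\<close> v(4)] by blast
  have cS: "c \<in> S" "congr G (v * c) c" using c(2) by (simp_all add: corner_central_def)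
  \<comment> \<open>The maximal ideal above \<open>principal d\<close> need not be known further: by
    uniqueness it is \<open>M\<close>.\<close>
  have in_M: "d \<in> M" if d: "corner_central d" "v \<notin> principal d" for d
  proof -
    have "d \<in> S" using d(1) by (simp add: corner_central_def)
    then obtain N where "maximal_over I N" "principal d \<subseteq> N"
      using exists_maximal[OF is_ideal_principal principal_superset d(2) core(4)] by blast
    then show ?thesis using unique principal_self[OF d(1)] by blast
  qed
  have part_c: "part n c = (if n = i then c else 0)" for n
    using part_homogeneous[OF c(3)] .
  have part_v': "part n v = (if n = 0 then v else 0)" for n
    using part_homogeneous[OF v(2)] .
  have part_cc: "part n (c * c) = (if n = 2 * i then c * c else 0)" for n
    using part_homogeneous[OF part_mult_homogeneous[OF c(3,3)], of n] by simp
  note zero = ideal_zero[OF core(1)]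
  have d1: "v + c \<in> M"
  proof (rule in_M)
    show "corner_central (v + c)" by (intro corner_central_add corner_central_v c)
    show "v \<notin> principal (v + c)"
    proof (rule v_notin_principal[where k = i and t = c'])
      show "support G (v + c) \<subseteq> {min 0 i..max 0 i}"
        using zero by (auto simp: support_def part_add part_c part_v' split: if_splits)
      show "c' * part i (v + c) - v \<in> G"
        using c by (simp add: part_add part_c part_v' congr_def)
    qed (use c cS zero in \<open>auto simp: part_add part_c part_v'\<close>)
  qed
  have d2: "v + c + c * c \<in> M"
  proof (rule in_M)
    show "corner_central (v + c + c * c)"
      by (intro corner_central_add corner_central_mult corner_central_v c)
    have "congr G (c' * c' * c * c) (c' * v * c)"
      using congr_mult_left[OF core(1) congr_mult_right[OF core(1) c(5) cS(1)] c(4)]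
      by (simp add: mult.assoc)
    moreover have "congr G (c' * v * c) (c' * c)"
      using congr_mult_left[OF core(1) cS(2) c(4)] by (simp add: mult.assoc)
    \<comment> \<open>The top component of the quadratic element is \<open>c * c\<close> in degree
      \<open>2 * i\<close>; its inverse is \<open>c' * c'\<close>, and the linear term lies strictly
      between the extremal degrees.\<close>
    ultimately have inv: "congr G (c' * c' * (c * c)) v"
      using congr_trans[OF core(1)] c(5) by (metis mult.assoc)
    show "v \<notin> principal (v + c + c * c)"
    proof (rule v_notin_principal[where k = "2 * i" and t = "c' * c'"])
      show "support G (v + c + c * c) \<subseteq> {min 0 (2 * i)..max 0 (2 * i)}"
        using zero by (auto simp: support_def part_add part_c part_v' part_cc split: if_splits)
      show "c' * c' * part (2 * i) (v + c + c * c) - v \<in> G"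
        using c(1) inv by (simp add: part_add part_c part_v' part_cc congr_def)
    qed (use c cS zero in \<open>auto simp: part_add part_c part_v' part_cc\<close>)
  qed
  \<comment> \<open>Corrects the identity 1 + c + c^2 - (1 + c) c = 1, since \<open>v\<close> is a
    unit for \<open>c\<close> only modulo \<open>G\<close>.\<close>
  have d3: "v * c - c \<in> M" using cS(2) core(3) by (auto simp: congr_def)
  have "(v + c + c * c) - (v + c) * c + (v * c - c) \<in> M"
    using ideal_add[OF M'(1) ideal_diff[OF M'(1) d2 ideal_mult_right[OF M'(1) d1 cS(1)]] d3] .
  then have "v \<in> M" by (simp add: algebra_simps)
  then show False using v(4) by contradiction
qed

end

section \<open>Left units in graded ideals\<close>

text \<open>The scalars \<open>sc a\<close> are central elements of the ambient unital ring and need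
  not lie in \<open>S\<close>; \<open>S\<close> and \<open>I\<close> are merely stable under
  multiplication by them. Congruences are therefore scaled by \<open>I_scale\<close> instead of
  \<open>I_left\<close>.\<close>

locale leavitt_family = graded_subring S part
  for S :: "'a::ring_1 set" and part :: "int \<Rightarrow> 'a \<Rightarrow> 'a" +
  fixes I :: "'a set" and sc :: "'k::field \<Rightarrow> 'a"
    and V :: "'v set" and A :: "'e set" and src rng :: "'e \<Rightarrow> 'v"
    and ve :: "'v \<Rightarrow> 'a" and ed gh :: "'e \<Rightarrow> 'a"
  assumes I: "is_ideal I"
    and sc_one: "sc 1 = 1" and sc_add: "sc (a + b) = sc a + sc b"
    and sc_mult: "sc (a * b) = sc a * sc b" and sc_comm: "sc a * x = x * sc a"
    and sc_closed [simp]: "x \<in> S \<Longrightarrow> sc a * x \<in> S"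
    and sc_ideal: "x \<in> I \<Longrightarrow> sc a * x \<in> I"
    and src_closed [simp]: "e \<in> A \<Longrightarrow> src e \<in> V"
    and rng_closed [simp]: "e \<in> A \<Longrightarrow> rng e \<in> V"
    and ve_closed [simp]: "v \<in> V \<Longrightarrow> ve v \<in> S"
    and ed_closed [simp]: "e \<in> A \<Longrightarrow> ed e \<in> S"
    and gh_closed [simp]: "e \<in> A \<Longrightarrow> gh e \<in> S"
    and ve_ve: "v \<in> V \<Longrightarrow> w \<in> V \<Longrightarrow> congr I (ve v * ve w) (if v = w then ve v else 0)"
    and src_ed: "e \<in> A \<Longrightarrow> congr I (ve (src e) * ed e) (ed e)"
    and ed_rng: "e \<in> A \<Longrightarrow> congr I (ed e * ve (rng e)) (ed e)"
    and rng_gh: "e \<in> A \<Longrightarrow> congr I (ve (rng e) * gh e) (gh e)"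
    and gh_src: "e \<in> A \<Longrightarrow> congr I (gh e * ve (src e)) (gh e)"
    and gh_ed: "e \<in> A \<Longrightarrow> f \<in> A \<Longrightarrow> congr I (gh e * ed f) (if e = f then ve (rng e) else 0)"
begin

lemmas I_refl = congr_refl[OF I] and I_sym = congr_sym[OF I] and I_trans [trans] = congr_trans[OF I]
  and I_add = congr_add[OF I] and I_diff = congr_diff[OF I]
  and I_sum = congr_sum[OF I]
  and I_left = congr_mult_left[OF I] and I_right = congr_mult_right[OF I]

lemma sc_zero: "sc 0 = 0"
  using sc_add[of 0 0] by simp

lemma sc_left: "x * (sc a * y) = sc a * (x * y)"
  by (metis mult.assoc sc_comm)

lemma I_scale: "congr I x y \<Longrightarrow> congr I (sc c * x) (sc c * y)"
  using sc_ideal[of "x - y" c] by (auto simp: congr_def right_diff_distrib)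

lemma ve_ed: 
  assumes "v \<in> V" "e \<in> A" shows "congr I (ve v * ed e) (if v = src e then ed e else 0)"
proof -
  have "congr I (ve v * ed e) (ve v * (ve (src e) * ed e))"
    using assms by (intro I_left I_sym[OF src_ed]) auto
  also have "ve v * (ve (src e) * ed e) = (ve v * ve (src e)) * ed e" by (simp add: mult.assoc)
  also have "congr I \<dots> ((if v = src e then ve v else 0) * ed e)"
    using assms by (intro I_right ve_ve) auto
  also have "congr I \<dots> (if v = src e then ed e else 0)"
    using assms src_ed I_refl by auto
  finally show ?thesis .
qed

lemma gh_ve:
  assumes "v \<in> V" "e \<in> A" shows "congr I (gh e * ve v) (if v = src e then gh e else 0)"
proof -
  have "congr I (gh e * ve v) ((gh e * ve (src e)) * ve v)"
    using assms by (intro I_right I_sym[OF gh_src]) auto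
  also have "gh e * ve (src e) * ve v = gh e * (ve (src e) * ve v)" by (simp add: mult.assoc)
  also have "congr I \<dots> (gh e * (if src e = v then ve (src e) else 0))"
    using assms by (intro I_left ve_ve) auto
  also have "congr I \<dots> (if v = src e then gh e else 0)"
    using assms gh_src I_refl by auto
  finally show ?thesis .
qed

section \<open>The span of the ghost paths\<close>

inductive ghost :: "int \<Rightarrow> 'a \<Rightarrow> bool" where
  ghost_zero: "ghost n 0"
| ghost_ve: "v \<in> V \<Longrightarrow> ghost 0 (sc c * ve v)"
| ghost_gh: "ghost n y \<Longrightarrow> g \<in> A \<Longrightarrow> ghost (n - 1) (y * gh g)"
| ghost_add: "ghost n x \<Longrightarrow> ghost n y \<Longrightarrow> ghost n (x + y)"
| ghost_cong: "ghost n x \<Longrightarrow> congr I x y \<Longrightarrow> ghost n y"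

lemma ghost_closed: "ghost n x \<Longrightarrow> x \<in> S"
  by (induction rule: ghost.induct) (auto simp: congr_def)

text \<open>Ghost paths have degree at most 0, so only elements congruent to zero remain in positive
  degree.\<close>

lemma ghost_pos: "ghost n x \<Longrightarrow> n > 0 \<Longrightarrow> x \<in> I"
proof (induction rule: ghost.induct)
  case (ghost_gh n y g)
  then show ?case using ideal_mult_right[OF I] by auto
next
  case (ghost_cong n x y)
  then show ?case using congr_mem_iff[OF I I order_refl] by blast
qed (auto intro: ideal_zero[OF I] ideal_add[OF I])

lemma ghost_ve_right: "ghost n x \<Longrightarrow> v \<in> V \<Longrightarrow> ghost n (x * ve v)"
proof (induction rule: ghost.induct)
  case (ghost_ve w c)
  have "congr I (sc c * (ve w * ve v)) (sc c * (if w = v then ve w else 0))"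
    using ghost_ve by (intro I_scale ve_ve) auto
  moreover have "ghost 0 (sc c * (if w = v then ve w else 0))"
    using ghost_ve ghost.ghost_ve[of w c] by (auto intro: ghost_zero)
  ultimately show ?case using ghost_cong I_sym by (metis mult.assoc)
next
  case (ghost_gh n y g)
  have "congr I (y * (gh g * ve v)) (y * (if v = src g then gh g else 0))"
    using ghost_gh ghost_closed by (intro I_left gh_ve) auto
  moreover have "ghost (n - 1) (y * (if v = src g then gh g else 0))"
    using ghost_gh ghost.ghost_gh[of n y g] by (auto intro: ghost_zero)
  ultimately show ?case using ghost_cong I_sym by (metis mult.assoc)
next
  case (ghost_add n x y)
  then show ?case using ghost.ghost_add by (simp add: distrib_right)
next
  case (ghost_cong n x y)
  then show ?case using ghost.ghost_cong I_right by (metis ve_closed)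
qed (auto intro: ghost_zero)

lemma ghost_ve_left: "ghost n x \<Longrightarrow> v \<in> V \<Longrightarrow> ghost n (ve v * x)"
proof (induction rule: ghost.induct)
  case (ghost_ve w c)
  have "congr I (sc c * (ve v * ve w)) (sc c * (if v = w then ve v else 0))"
    using ghost_ve by (intro I_scale ve_ve) auto
  moreover have "ghost 0 (sc c * (if v = w then ve v else 0))"
    using ghost_ve ghost.ghost_ve[of w c] by (auto intro: ghost_zero)
  ultimately show ?case using ghost_cong I_sym sc_left by metis
next
  case (ghost_gh n y g)
  then show ?case using ghost.ghost_gh by (metis mult.assoc)
next
  case (ghost_add n x y)
  then show ?case using ghost.ghost_add by (simp add: distrib_left)
next
  case (ghost_cong n x y)
  then show ?case using ghost.ghost_cong I_left by (metis ve_closed)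
qed (auto intro: ghost_zero)

lemma ghost_gh_left: "ghost n x \<Longrightarrow> e \<in> A \<Longrightarrow> ghost (n - 1) (gh e * x)"
proof (induction rule: ghost.induct)
  case (ghost_ve w c)
  have "congr I (sc c * (gh e * ve w)) (sc c * (if w = src e then gh e else 0))"
    using ghost_ve by (intro I_scale gh_ve) auto
  moreover have "ghost (0 - 1) (sc c * (if w = src e then gh e else 0))"
  proof -
    have "ghost (0 - 1) (sc c * ve (rng e) * gh e)"
      using ghost_ve by (intro ghost.ghost_gh ghost.ghost_ve) auto
    moreover have "congr I (sc c * (ve (rng e) * gh e)) (sc c * gh e)"
      using ghost_ve by (intro I_scale rng_gh)
    ultimately have "ghost (0 - 1) (sc c * gh e)" using ghost_cong by (metis mult.assoc)
    then show ?thesis by (auto intro: ghost_zero)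
  qed
  ultimately show ?case using ghost_cong I_sym sc_left by metis
next
  case (ghost_gh n y g)
  then show ?case using ghost.ghost_gh by (metis mult.assoc)
next
  case (ghost_add n x y)
  then show ?case using ghost.ghost_add by (simp add: distrib_left)
next
  case (ghost_cong n x y)
  then show ?case using ghost.ghost_cong I_left by (metis gh_closed)
qed (auto intro: ghost_zero)

text \<open>In negative degree every ghost path ends in a ghost edge, and \<open>gh_ed\<close>
  cancels it against the edge. In degree 0 an edge would remain.\<close>

lemma ghost_ed_right: "ghost n x \<Longrightarrow> n < 0 \<Longrightarrow> e \<in> A \<Longrightarrow> ghost (n + 1) (x * ed e)"
proof (induction rule: ghost.induct)
  case (ghost_gh n y g)
  have "congr I (y * (gh g * ed e)) (y * (if g = e then ve (rng g) else 0))"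
    using ghost_gh ghost_closed by (intro I_left gh_ed) auto
  moreover have "ghost n (y * (if g = e then ve (rng g) else 0))"
    using ghost_gh ghost_ve_right[of n y "rng g"] by (auto intro: ghost_zero)
  ultimately have "ghost n (y * gh g * ed e)" using ghost_cong I_sym by (metis mult.assoc)
  then show ?case by simp
next
  case (ghost_add n x y)
  then show ?case using ghost.ghost_add by (simp add: distrib_right)
next
  case (ghost_cong n x y)
  then show ?case using ghost.ghost_cong I_right by (metis ed_closed)
qed (auto intro: ghost_zero)

lemma I_sum_single:
  assumes "finite F" "e \<in> F" "\<And>f. f \<in> F \<Longrightarrow> congr I (h f) (if f = e then x else 0)"
  shows "congr I (sum h F) x"
proof -
  have "congr I (sum h F) (\<Sum>f\<in>F. if f = e then x else 0)" by (rule I_sum[OF assms(3)])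
  then show ?thesis using assms(1,2) by simp
qed

text \<open>A last ghost edge \<open>gh e\<close> is reproduced by the term \<open>g = e\<close>,
  and the other terms vanish. The claim covers all larger finite sets so that a union serves for a
  sum of two elements; \<open>has_local_unit\<close> and \<open>filt_decompose\<close> have the same
  form for the same reason.\<close>

lemma ghost_expand:
  "ghost n x \<Longrightarrow> n < 0 \<Longrightarrow> \<exists>F. finite F \<and> F \<subseteq> A \<and>
     (\<forall>F'. finite F' \<longrightarrow> F \<subseteq> F' \<longrightarrow> F' \<subseteq> A \<longrightarrow> congr I (\<Sum>g\<in>F'. x * ed g * gh g) x)"
proof (induction rule: ghost.induct)
  case (ghost_zero n)
  then show ?case using I_refl[OF zero_closed] by auto
next
  case (ghost_gh n y e)
  have yS: "y \<in> S" using ghost_gh ghost_closed by blast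
  have "congr I (\<Sum>g\<in>F'. y * gh e * ed g * gh g) (y * gh e)"
    if F': "finite F'" "{e} \<subseteq> F'" "F' \<subseteq> A" for F'
  proof (rule I_sum_single[OF F'(1)])
    show "e \<in> F'" using F' by simp
    fix g assume "g \<in> F'"
    then have g: "g \<in> A" using F' by blast
    have "congr I (y * (gh e * ed g) * gh g) (y * (if e = g then ve (rng e) else 0) * gh g)"
      using yS g ghost_gh(2) by (intro I_right I_left gh_ed) auto
    also have "congr I \<dots> (if g = e then y * gh e else 0)"
      using I_left[OF rng_gh[OF ghost_gh(2)] yS] I_refl[OF zero_closed]
      by (auto simp: mult.assoc)
    finally show "congr I (y * gh e * ed g * gh g) (if g = e then y * gh e else 0)"
      by (simp add: mult.assoc)
  qed
  then show ?case using ghost_gh(2) by (intro exI[of _ "{e}"]) auto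
next
  case (ghost_add n x y)
  then obtain F G where F: "finite F" "F \<subseteq> A" "finite G" "G \<subseteq> A"
    and x: "\<And>F'. finite F' \<Longrightarrow> F \<subseteq> F' \<Longrightarrow> F' \<subseteq> A \<Longrightarrow> congr I (\<Sum>g\<in>F'. x * ed g * gh g) x"
    and y: "\<And>F'. finite F' \<Longrightarrow> G \<subseteq> F' \<Longrightarrow> F' \<subseteq> A \<Longrightarrow> congr I (\<Sum>g\<in>F'. y * ed g * gh g) y"
    by blast
  have "congr I (\<Sum>g\<in>F'. (x + y) * ed g * gh g) (x + y)"
    if "finite F'" "F \<union> G \<subseteq> F'" "F' \<subseteq> A" for F'
    using I_add[OF x[of F'] y[of F']] that by (simp add: distrib_right sum.distrib)
  then show ?case using F by (intro exI[of _ "F \<union> G"]) auto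
next
  case (ghost_cong n x y)
  from ghost_cong.IH[OF ghost_cong.prems] obtain F where F: "finite F" "F \<subseteq> A"
    and x: "\<And>F'. finite F' \<Longrightarrow> F \<subseteq> F' \<Longrightarrow> F' \<subseteq> A \<Longrightarrow> congr I (\<Sum>g\<in>F'. x * ed g * gh g) x"
    by blast
  have "congr I (\<Sum>g\<in>F'. y * ed g * gh g) y"
    if F': "finite F'" "F \<subseteq> F'" "F' \<subseteq> A" for F'
  proof -
    have "congr I (\<Sum>g\<in>F'. y * ed g * gh g) (\<Sum>g\<in>F'. x * ed g * gh g)"
      using F' by (intro I_sum I_right I_sym[OF ghost_cong(2)]) auto
    then show ?thesis using I_trans[OF I_trans[OF _ x[OF F']] ghost_cong(2)] by blast
  qed
  then show ?case using F by (intro exI[of _ F]) auto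
qed auto

lemma ghost_degree_zero:
  "ghost n x \<Longrightarrow> n = 0 \<Longrightarrow> v \<in> V \<Longrightarrow> \<exists>c. congr I (ve v * x) (sc c * ve v)"
proof (induction rule: ghost.induct)
  case (ghost_zero n)
  then show ?case using I_refl[OF zero_closed] by (intro exI[of _ 0]) (simp add: sc_zero)
next
  case (ghost_ve w c)
  have "congr I (sc c * (ve v * ve w)) (sc c * (if v = w then ve v else 0))"
    using ghost_ve by (intro I_scale ve_ve) auto
  then have "congr I (ve v * (sc c * ve w)) (sc (if v = w then c else 0) * ve v)"
    by (auto simp: sc_left sc_zero)
  then show ?case by blast
next
  case (ghost_gh n y g)
  \<comment> \<open>The product has degree 0, so \<open>y\<close> has degree 1 and lies in
    \<open>I\<close>.\<close>
  then have "y * gh g \<in> I" using ghost_pos ideal_mult_right[OF I] by auto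
  then have "ve v * (y * gh g) \<in> I" using ideal_mult_left[OF I] ghost_gh by auto
  then show ?case using congr_zero_iff[OF I] by (intro exI[of _ 0]) (simp add: sc_zero)
next
  case (ghost_add n x y)
  then obtain c d where "congr I (ve v * x) (sc c * ve v)" "congr I (ve v * y) (sc d * ve v)"
    by blast
  then have "congr I (ve v * (x + y)) (sc (c + d) * ve v)"
    using I_add by (simp add: distrib_left distrib_right sc_add)
  then show ?case by blast
next
  case (ghost_cong n x y)
  then obtain c where "congr I (ve v * x) (sc c * ve v)" by blast
  moreover have "congr I (ve v * y) (ve v * x)"
    using ghost_cong by (intro I_left I_sym[OF ghost_cong(2)]) auto
  ultimately show ?case using I_trans by blast
qed

text \<open>Multiplying \<open>p z\<close> by the edges of a ghost path occurring in \<open>z\<close> leaves a multiple of \<open>p\<close>.\<close>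

lemma ghost_corner:
  assumes J: "is_ideal J" "I \<subseteq> J" and p: "p \<in> S" "v \<in> V" "congr I (p * ve v) p"
    and z: "ghost n z" "p * z \<in> J" "p * z \<notin> I"
  shows "p \<in> J"
  using z
proof (induction k \<equiv> "nat (- n)" arbitrary: n z)
  case 0
  have zS: "z \<in> S" using 0 ghost_closed by blast
  have "\<not> n > 0" using ghost_pos[OF 0(2)] 0(4) ideal_mult_left[OF I] p(1) by blast
  then have "n = 0" using 0(1) by simp
  then obtain c where c: "congr I (ve v * z) (sc c * ve v)"
    using ghost_degree_zero[OF 0(2) _ p(2)] by blast
  have "congr I (p * z) ((p * ve v) * z)" using zS by (intro I_right I_sym[OF p(3)])
  also have "(p * ve v) * z = p * (ve v * z)" by (rule mult.assoc)
  also have "congr I (p * (ve v * z)) (p * (sc c * ve v))" using p c by (intro I_left)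
  also have "p * (sc c * ve v) = sc c * (p * ve v)" by (rule sc_left)
  also have "congr I (sc c * (p * ve v)) (sc c * p)" using p by (intro I_scale)
  finally have pz: "congr I (p * z) (sc c * p)" .
  have scp: "sc c * p \<notin> I" "sc c * p \<in> J"
    using congr_mem_iff[OF I I order_refl pz] congr_mem_iff[OF I J pz] 0(3,4) by blast+
  have "c \<noteq> 0" using scp(1) ideal_zero[OF I] by (auto simp: sc_zero)
  \<comment> \<open>\<open>J\<close> is only assumed to be a ring ideal, so the division by
    \<open>c\<close> is carried out by multiplying with an element of \<open>S\<close>.\<close>
  have "(sc c * p) * (sc (inverse c) * ve v) = sc (inverse c * c) * (p * ve v)"
    unfolding sc_left[of "sc c * p"] sc_mult by (simp only: mult.assoc)
  also have "\<dots> = p * ve v" using \<open>c \<noteq> 0\<close> by (simp add: sc_one)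
  finally have "p * ve v \<in> J"
    using ideal_mult_right[OF J(1) scp(2)] p(2) by (metis sc_closed ve_closed)
  then show ?case using congr_mem_iff[OF I J p(3)] by blast
next
  case (Suc k)
  have n: "n < 0" using Suc(2) by simp
  have zS: "z \<in> S" using Suc ghost_closed by blast
  obtain F where F: "finite F" "F \<subseteq> A" "congr I (\<Sum>g\<in>F. z * ed g * gh g) z"
    using ghost_expand[OF Suc(3) n] by blast
  have "congr I (p * (\<Sum>g\<in>F. z * ed g * gh g)) (p * z)" using F p by (intro I_left)
  from congr_mem_iff[OF I I order_refl this]
  have "p * (\<Sum>g\<in>F. z * ed g * gh g) \<notin> I" using Suc(5) by simp
  moreover have "p * (\<Sum>g\<in>F. z * ed g * gh g) = (\<Sum>g\<in>F. p * (z * ed g) * gh g)"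
    by (simp add: sum_distrib_left mult.assoc)
  ultimately have "(\<Sum>g\<in>F. p * (z * ed g) * gh g) \<notin> I" by simp
  \<comment> \<open>One term of the expansion survives modulo \<open>I\<close>; its edge shortens
    the ghost part by one while the product stays in \<open>J\<close> and outside
    \<open>I\<close>.\<close>
  then obtain g where g: "g \<in> F" "p * (z * ed g) * gh g \<notin> I"
    using ideal_sum[OF I, of F "\<lambda>g. p * (z * ed g) * gh g"] by blast
  have gA: "g \<in> A" using g F by blast
  have "p * (z * ed g) \<notin> I" using g ideal_mult_right[OF I] gA by auto
  moreover have "p * (z * ed g) \<in> J"
    using ideal_mult_right[OF J(1) Suc(4), of "ed g"] gA by (simp add: mult.assoc)
  moreover have "ghost (n + 1) (z * ed g)" by (rule ghost_ed_right[OF Suc(3) n gA])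
  moreover have "k = nat (- (n + 1))" using Suc(2) by simp
  ultimately show ?case using Suc(1)[of "n + 1" "z * ed g"] by blast
qed


section \<open>Finite sums of vertices as local units\<close>

definition has_local_unit :: "'a \<Rightarrow> bool" where
  "has_local_unit x \<longleftrightarrow> (\<exists>W. finite W \<and> W \<subseteq> V \<and>
     (\<forall>W'. finite W' \<longrightarrow> W \<subseteq> W' \<longrightarrow> W' \<subseteq> V \<longrightarrow> congr I (\<Sum>v\<in>W'. ve v * x) x))"

lemma has_local_unitI:
  assumes "finite W" "W \<subseteq> V"
    and "\<And>W'. finite W' \<Longrightarrow> W \<subseteq> W' \<Longrightarrow> W' \<subseteq> V \<Longrightarrow> congr I (\<Sum>v\<in>W'. ve v * x) x"
  shows "has_local_unit x"
  unfolding has_local_unit_def using assms by (intro exI[of _ W]) auto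

lemma has_local_unit_zero: "has_local_unit 0"
  by (rule has_local_unitI[of "{}"]) (auto intro: I_refl)

lemma has_local_unit_diff:
  assumes "has_local_unit x" "has_local_unit y"
  shows "has_local_unit (x - y)"
proof -
  obtain W where W: "finite W" "W \<subseteq> V"
    "\<And>W'. finite W' \<Longrightarrow> W \<subseteq> W' \<Longrightarrow> W' \<subseteq> V \<Longrightarrow> congr I (\<Sum>v\<in>W'. ve v * x) x"
    using assms(1) unfolding has_local_unit_def by blast
  obtain U where U: "finite U" "U \<subseteq> V"
    "\<And>W'. finite W' \<Longrightarrow> U \<subseteq> W' \<Longrightarrow> W' \<subseteq> V \<Longrightarrow> congr I (\<Sum>v\<in>W'. ve v * y) y"
    using assms(2) unfolding has_local_unit_def by blast
  show ?thesis
  proof (rule has_local_unitI[of "W \<union> U"])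
    fix W' assume "finite W'" "W \<union> U \<subseteq> W'" "W' \<subseteq> V"
    then show "congr I (\<Sum>v\<in>W'. ve v * (x - y)) (x - y)"
      using I_diff[OF W(3)[of W'] U(3)[of W']] by (simp add: right_diff_distrib sum_subtractf)
  qed (use W U in auto)
qed

lemma has_local_unit_add: "has_local_unit x \<Longrightarrow> has_local_unit y \<Longrightarrow> has_local_unit (x + y)"
  using has_local_unit_diff[of x "0 - y"] has_local_unit_diff[OF has_local_unit_zero, of y] by simp

lemma has_local_unit_sum: "(\<And>a. a \<in> B \<Longrightarrow> has_local_unit (f a)) \<Longrightarrow> has_local_unit (sum f B)"
  by (induction B rule: infinite_finite_induct) (auto intro: has_local_unit_zero has_local_unit_add)

lemma has_local_unit_mult:
  assumes "has_local_unit x" "a \<in> S"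
  shows "has_local_unit (x * a)"
proof -
  obtain W where W: "finite W" "W \<subseteq> V"
    "\<And>W'. finite W' \<Longrightarrow> W \<subseteq> W' \<Longrightarrow> W' \<subseteq> V \<Longrightarrow> congr I (\<Sum>v\<in>W'. ve v * x) x"
    using assms(1) unfolding has_local_unit_def by blast
  show ?thesis
  proof (rule has_local_unitI[of W])
    fix W' assume "finite W'" "W \<subseteq> W'" "W' \<subseteq> V"
    then show "congr I (\<Sum>v\<in>W'. ve v * (x * a)) (x * a)"
      using I_right[OF W(3)[of W'] assms(2)] by (simp add: sum_distrib_right mult.assoc)
  qed (use W in auto)
qed

lemma has_local_unit_scale:
  assumes "has_local_unit x"
  shows "has_local_unit (sc c * x)"
proof -
  obtain W where W: "finite W" "W \<subseteq> V"
    "\<And>W'. finite W' \<Longrightarrow> W \<subseteq> W' \<Longrightarrow> W' \<subseteq> V \<Longrightarrow> congr I (\<Sum>v\<in>W'. ve v * x) x"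
    using assms(1) unfolding has_local_unit_def by blast
  show ?thesis
  proof (rule has_local_unitI[of W])
    fix W' assume "finite W'" "W \<subseteq> W'" "W' \<subseteq> V"
    moreover have "(\<Sum>v\<in>W'. ve v * (sc c * x)) = sc c * (\<Sum>v\<in>W'. ve v * x)"
      unfolding sum_distrib_left by (rule sum.cong[OF refl]) (rule sc_left)
    ultimately show "congr I (\<Sum>v\<in>W'. ve v * (sc c * x)) (sc c * x)"
      using I_scale[OF W(3)[of W']] by simp
  qed (use W in auto)
qed

lemma has_local_unit_cong:
  assumes "has_local_unit x" "congr I x y"
  shows "has_local_unit y"
proof -
  obtain W where W: "finite W" "W \<subseteq> V"
    "\<And>W'. finite W' \<Longrightarrow> W \<subseteq> W' \<Longrightarrow> W' \<subseteq> V \<Longrightarrow> congr I (\<Sum>v\<in>W'. ve v * x) x"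
    using assms(1) unfolding has_local_unit_def by blast
  show ?thesis
  proof (rule has_local_unitI[of W])
    fix W' assume W': "finite W'" "W \<subseteq> W'" "W' \<subseteq> V"
    have "congr I (\<Sum>v\<in>W'. ve v * y) (\<Sum>v\<in>W'. ve v * x)"
      using W' by (intro I_sum I_left I_sym[OF assms(2)]) auto
    then show "congr I (\<Sum>v\<in>W'. ve v * y) y"
      using I_trans[OF I_trans[OF _ W(3)[OF W']] assms(2)] by blast
  qed (use W in auto)
qed

lemma has_local_unit_single:
  assumes "v \<in> V" "\<And>w. w \<in> V \<Longrightarrow> congr I (ve w * x) (if w = v then x else 0)"
  shows "has_local_unit x"
proof (rule has_local_unitI[of "{v}"])
  fix W' assume W': "finite W'" "{v} \<subseteq> W'" "W' \<subseteq> V"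
  show "congr I (\<Sum>w\<in>W'. ve w * x) x"
  proof (rule I_sum_single[OF W'(1)])
    show "congr I (ve w * x) (if w = v then x else 0)" if "w \<in> W'" for w
      by (rule assms(2)) (use that W' in blast)
  qed (use W' in blast)
qed (use assms in auto)

lemma has_local_unit_ve: "v \<in> V \<Longrightarrow> has_local_unit (ve v)"
proof (rule has_local_unit_single[of v])
  fix w assume "v \<in> V" "w \<in> V"
  then show "congr I (ve w * ve v) (if w = v then ve v else 0)" using ve_ve[of w v] by (simp split: if_splits)
qed

lemma has_local_unit_ed: "e \<in> A \<Longrightarrow> has_local_unit (ed e)"
  using ve_ed by (intro has_local_unit_single[of "src e"]) auto

lemma ghost_local_unit: "ghost n x \<Longrightarrow> has_local_unit x"
proof (induction rule: ghost.induct)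
  case (ghost_cong n x y)
  then show ?case using has_local_unit_cong by blast
qed (auto intro: has_local_unit_zero has_local_unit_add has_local_unit_scale has_local_unit_ve
    has_local_unit_mult)

section \<open>Left units by induction on the length of paths\<close>

definition range_sum :: "'e set \<Rightarrow> 'a" where
  "range_sum F = (\<Sum>e\<in>F. ed e * gh e)"

lemma range_sum_closed [simp]: "F \<subseteq> A \<Longrightarrow> range_sum F \<in> S"
  unfolding range_sum_def by (rule sum_closed) auto

lemma range_sum_mult: "range_sum F * x = (\<Sum>e\<in>F. ed e * (gh e * x))"
  by (simp add: range_sum_def sum_distrib_right mult.assoc)

text \<open>Lets the elements \<open>p v\<close> of the next lemma absorb \<open>v\<close> on the
  right, as \<open>ghost_corner\<close> requires.\<close>

lemma range_sum_ve:
  assumes "F \<subseteq> A" "v \<in> V"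
  shows "congr I (range_sum F * ve v) (ve v * range_sum F)"
  unfolding range_sum_mult unfolding range_sum_def sum_distrib_left
proof (rule I_sum)
  fix e assume "e \<in> F"
  then have e: "e \<in> A" using assms by blast
  have "congr I (ed e * (gh e * ve v)) (ed e * (if v = src e then gh e else 0))"
    using assms e by (intro I_left gh_ve) auto
  also have "ed e * (if v = src e then gh e else 0) = (if v = src e then ed e else 0) * gh e"
    by simp
  also have "congr I \<dots> ((ve v * ed e) * gh e)"
    using assms e by (intro I_right I_sym[OF ve_ed]) auto
  also have "(ve v * ed e) * gh e = ve v * (ed e * gh e)" by (rule mult.assoc)
  finally show "congr I (ed e * (gh e * ve v)) (ve v * (ed e * gh e))" .
qed

text \<open>The left unit is \<open>\<Sum> p\<^sub>v + \<Sum> e u\<^sub>e e\<^sup>*\<close>, where \<open>p\<^sub>v = v - \<Sum> e e\<^sup>*\<close> (the sum over the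
  edges \<open>e\<close> in \<open>F\<close> with source \<open>v\<close>) is omitted unless it lies in \<open>J\<close>.\<close>

lemma left_unit_step:
  assumes J: "is_ideal J" "I \<subseteq> J" and x: "x \<in> J" "has_local_unit (x - range_sum F * x)"
    and z: "ghost n z" and F: "finite F" "F \<subseteq> A"
    and xz: "congr I (x - range_sum F * x) (z - range_sum F * z)"
    and unit: "\<And>e. e \<in> F \<Longrightarrow> \<exists>u\<in>J. u * (gh e * x) - gh e * x \<in> I"
  shows "\<exists>u\<in>J. u * x - x \<in> I"
proof -
  define q where "q = range_sum F"
  have q: "q \<in> S" using F by (simp add: q_def)
  have xS: "x \<in> S" using ideal_subset[OF J(1) x(1)] .
  have zS: "z \<in> S" using ghost_closed[OF z] .
  obtain U where U: "\<And>e. e \<in> F \<Longrightarrow> U e \<in> J" "\<And>e. e \<in> F \<Longrightarrow> U e * (gh e * x) - gh e * x \<in> I"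
    using unit by metis
  obtain W where W: "finite W" "W \<subseteq> V" "congr I (\<Sum>v\<in>W. ve v * (x - q * x)) (x - q * x)"
    using x(2) unfolding has_local_unit_def q_def by (metis order_refl)
  define p where "p v = ve v - ve v * q" for v
  have pS: "p v \<in> S" if "v \<in> V" for v using that q by (simp add: p_def)
  have p_mult: "p v * y = ve v * (y - q * y)" for v y
    by (simp add: p_def left_diff_distrib right_diff_distrib mult.assoc)
  have p_ve: "congr I (p v * ve v) (p v)" if v: "v \<in> V" for v
  proof -
    have vv: "congr I (ve v * ve v) (ve v)" using ve_ve[OF v v] by simp
    have "congr I (ve v * (q * ve v)) (ve v * (ve v * q))"
      unfolding q_def using v F by (intro I_left range_sum_ve) auto
    also have "ve v * (ve v * q) = (ve v * ve v) * q" by (simp add: mult.assoc)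
    also have "congr I \<dots> (ve v * q)" using q by (intro I_right vv)
    finally have "congr I (ve v * ve v - ve v * (q * ve v)) (ve v - ve v * q)"
      using I_diff[OF vv] by blast
    then show ?thesis by (simp add: p_def left_diff_distrib mult.assoc)
  qed
  \<comment> \<open>Omitting \<open>p v\<close> does no harm: \<open>p v * x\<close> is congruent to
    \<open>p v * z\<close> with \<open>z\<close> in the span of the ghost paths, and if this were
    nonzero modulo \<open>I\<close>, \<open>ghost_corner\<close> would put \<open>p v\<close> into
    \<open>J\<close>.\<close>
  have p_x: "congr I ((if p v \<in> J then p v else 0) * x) (p v * x)" if v: "v \<in> V" for v
  proof (cases "p v \<in> J")
    case True
    then show ?thesis using xS pS[OF v] by (auto intro: I_refl)
  next
    case False
    have pxz: "congr I (p v * x) (p v * z)"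
      unfolding p_mult using xz v unfolding q_def by (intro I_left) auto
    have "p v * x \<in> J" using ideal_mult_left[OF J(1) x(1) pS[OF v]] .
    then have "p v * z \<in> J" using congr_mem_iff[OF I J pxz] by blast
    then have "p v * z \<in> I" using ghost_corner[OF J pS[OF v] v p_ve[OF v] z] False by blast
    then have "p v * x \<in> I" using congr_mem_iff[OF I I order_refl pxz] by blast
    then show ?thesis using False I_sym congr_zero_iff[OF I] by simp
  qed
  define u where "u = (\<Sum>v\<in>W. if p v \<in> J then p v else 0) + (\<Sum>e\<in>F. ed e * (U e * gh e))"
  have "u \<in> J"
    unfolding u_def
  proof (intro ideal_add[OF J(1)] ideal_sum[OF J(1)])
    show "(if p v \<in> J then p v else 0) \<in> J" for v using ideal_zero[OF J(1)] by simp
    show "ed e * (U e * gh e) \<in> J" if "e \<in> F" for e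
      using that F by (intro ideal_mult_left[OF J(1)] ideal_mult_right[OF J(1)] U(1)) auto
  qed
  \<comment> \<open>The two sums of \<open>u\<close> recover \<open>x - q * x\<close> and
    \<open>q * x\<close> respectively.\<close>
  moreover have "congr I (u * x) x"
  proof -
    have "u * x = (\<Sum>v\<in>W. (if p v \<in> J then p v else 0) * x) + (\<Sum>e\<in>F. ed e * (U e * (gh e * x)))"
      by (simp add: u_def distrib_right sum_distrib_right mult.assoc)
    also have "congr I \<dots> ((\<Sum>v\<in>W. p v * x) + (\<Sum>e\<in>F. ed e * (gh e * x)))"
    proof (intro I_add I_sum)
      show "congr I ((if p v \<in> J then p v else 0) * x) (p v * x)" if "v \<in> W" for v
        using that W p_x by blast
      show "congr I (ed e * (U e * (gh e * x))) (ed e * (gh e * x))" if "e \<in> F" for e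
        using that F U xS ideal_subset[OF J(1)]
        by (intro I_left) (auto simp: congr_def subset_iff)
    qed
    also have "(\<Sum>v\<in>W. p v * x) + (\<Sum>e\<in>F. ed e * (gh e * x)) =
        (\<Sum>v\<in>W. ve v * (x - q * x)) + q * x"
      by (simp add: p_mult q_def range_sum_mult)
    also have "congr I \<dots> ((x - q * x) + q * x)"
      using W xS q by (intro I_add I_refl) auto
    also have "(x - q * x) + q * x = x" by simp
    finally show ?thesis .
  qed
  ultimately show ?thesis by (auto simp: congr_def)
qed

text \<open>\<open>filt N n\<close> holds the elements of degree \<open>n\<close> spanned by products of a path of length at most
  \<open>N\<close> and a ghost path.\<close>

inductive filt :: "nat \<Rightarrow> int \<Rightarrow> 'a \<Rightarrow> bool" where
  filt_ghost: "ghost n x \<Longrightarrow> filt N n x"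
| filt_ed: "filt N n y \<Longrightarrow> e \<in> A \<Longrightarrow> filt (Suc N) (n + 1) (ed e * y)"
| filt_add: "filt N n x \<Longrightarrow> filt N n y \<Longrightarrow> filt N n (x + y)"
| filt_cong: "filt N n x \<Longrightarrow> congr I x y \<Longrightarrow> filt N n y"

lemma filt_closed: "filt N n x \<Longrightarrow> x \<in> S"
  by (induction rule: filt.induct) (auto simp: congr_def ghost_closed)

lemma filt_local_unit: "filt N n x \<Longrightarrow> has_local_unit x"
proof (induction rule: filt.induct)
  case (filt_ed N n y e)
  then show ?case using has_local_unit_mult[OF has_local_unit_ed] filt_closed by blast
next
  case (filt_cong N n x y)
  then show ?case using has_local_unit_cong by blast
qed (auto intro: ghost_local_unit has_local_unit_add)

lemma filt_Suc: "filt N n x \<Longrightarrow> filt (Suc N) n x"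
  by (induction rule: filt.induct) (auto intro: filt.intros)

lemma filt_mono: "N \<le> N' \<Longrightarrow> filt N n x \<Longrightarrow> filt N' n x"
  by (induction N' rule: dec_induct) (auto intro: filt_Suc)

lemma filt_zero_ghost: "filt N n x \<Longrightarrow> N = 0 \<Longrightarrow> ghost n x"
  by (induction rule: filt.induct) (auto intro: ghost.intros)

lemma filt_ve_left: "filt N n x \<Longrightarrow> v \<in> V \<Longrightarrow> filt N n (ve v * x)"
proof (induction rule: filt.induct)
  case (filt_ghost n x N)
  then show ?case using ghost_ve_left filt.filt_ghost by blast
next
  case (filt_ed N n y e)
  have "congr I ((if v = src e then ed e else 0) * y) (ve v * ed e * y)"
    using filt_ed filt_closed by (intro I_right I_sym[OF ve_ed]) auto
  moreover have "filt (Suc N) (n + 1) ((if v = src e then ed e else 0) * y)"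
    using filt_ed filt.filt_ed[of N n y e] filt_ghost[OF ghost_zero] by auto
  ultimately show ?case using filt_cong by (metis mult.assoc)
next
  case (filt_add N n x y)
  then show ?case using filt.filt_add by (simp add: distrib_left)
next
  case (filt_cong N n x y)
  then show ?case using filt.filt_cong I_left by (metis ve_closed)
qed

text \<open>By \<open>gh_ed\<close> a ghost edge removes the first edge of a path. The truncated
  subtraction is right at \<open>N = 0\<close>, where a ghost path with a ghost edge in front is
  again a ghost path.\<close>

lemma filt_gh_left: "filt N n x \<Longrightarrow> e \<in> A \<Longrightarrow> filt (N - 1) (n - 1) (gh e * x)"
proof (induction rule: filt.induct)
  case (filt_ghost n x N)
  then show ?case using ghost_gh_left filt.filt_ghost by blast
next
  case (filt_ed N n y f)
  have "congr I ((if e = f then ve (rng e) else 0) * y) (gh e * ed f * y)"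
    using filt_ed filt_closed by (intro I_right I_sym[OF gh_ed]) auto
  moreover have "filt N n ((if e = f then ve (rng e) else 0) * y)"
    using filt_ed filt_ve_left[of N n y "rng e"] filt_ghost[OF ghost_zero] by auto
  ultimately have "filt N n (gh e * (ed f * y))" using filt_cong by (metis mult.assoc)
  then show ?case by simp
next
  case (filt_add N n x y)
  then show ?case using filt.filt_add by (simp add: distrib_left)
next
  case (filt_cong N n x y)
  then show ?case using filt.filt_cong I_left by (metis gh_closed)
qed

text \<open>Modulo \<open>I\<close> the products of an edge and its own ghost edge are orthogonal
  idempotents, so \<open>range_sum F\<close> projects onto the elements that begin with an edge in
  \<open>F\<close>.\<close>

lemma range_sum_ed:
  assumes "finite F" "F \<subseteq> A" "e \<in> F"
  shows "congr I (range_sum F * ed e) (ed e)"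
  unfolding range_sum_mult
proof (rule I_sum_single[OF assms(1,3)])
  fix f assume "f \<in> F"
  then have f: "f \<in> A" "e \<in> A" using assms by auto
  have "congr I (ed f * (gh f * ed e)) (ed f * (if f = e then ve (rng f) else 0))"
    using f by (intro I_left gh_ed) auto
  also have "congr I \<dots> (if f = e then ed e else 0)"
    using ed_rng[OF f(1)] I_refl[OF zero_closed] by auto
  finally show "congr I (ed f * (gh f * ed e)) (if f = e then ed e else 0)" .
qed

text \<open>Subtracting the projection by \<open>range_sum F'\<close> removes all terms that begin
  with an edge in \<open>F'\<close>, so that only the pure ghost part \<open>z\<close> of
  \<open>x\<close> counts.\<close>

lemma filt_decompose:
  "filt N n x \<Longrightarrow> \<exists>z F. ghost n z \<and> finite F \<and> F \<subseteq> A \<and>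
     (\<forall>F'. finite F' \<longrightarrow> F \<subseteq> F' \<longrightarrow> F' \<subseteq> A \<longrightarrow>
       congr I (x - range_sum F' * x) (z - range_sum F' * z))"
proof (induction rule: filt.induct)
  case (filt_ghost n x N)
  then show ?case using ghost_closed[OF filt_ghost]
    by (intro exI[of _ x] exI[of _ "{}"]) (auto intro!: I_refl)
next
  case (filt_ed N n y e)
  have yS: "y \<in> S" using filt_ed filt_closed by blast
  have "congr I (ed e * y - range_sum F' * (ed e * y)) 0"
    if F': "finite F'" "{e} \<subseteq> F'" "F' \<subseteq> A" for F'
  proof -
    have "congr I (range_sum F' * ed e * y) (ed e * y)"
      using F' yS by (intro I_right range_sum_ed) auto
    then have "congr I (ed e * y - range_sum F' * ed e * y) (ed e * y - ed e * y)"
      using F' yS by (intro I_diff I_refl) auto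
    then show ?thesis by (simp add: mult.assoc)
  qed
  then show ?case using filt_ed(2)
    by (intro exI[of _ 0] exI[of _ "{e}"]) (auto intro: ghost_zero)
next
  case (filt_add N n x y)
  from filt_add.IH(1) obtain z F where z: "ghost n z" "finite F" "F \<subseteq> A"
    "\<And>F'. finite F' \<Longrightarrow> F \<subseteq> F' \<Longrightarrow> F' \<subseteq> A \<Longrightarrow> congr I (x - range_sum F' * x) (z - range_sum F' * z)"
    by auto
  from filt_add.IH(2) obtain w H where w: "ghost n w" "finite H" "H \<subseteq> A"
    "\<And>F'. finite F' \<Longrightarrow> H \<subseteq> F' \<Longrightarrow> F' \<subseteq> A \<Longrightarrow> congr I (y - range_sum F' * y) (w - range_sum F' * w)"
    by auto
  have "congr I ((x + y) - range_sum F' * (x + y)) ((z + w) - range_sum F' * (z + w))"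
    if "finite F'" "F \<union> H \<subseteq> F'" "F' \<subseteq> A" for F'
    using I_add[OF z(4)[of F'] w(4)[of F']] that by (simp add: distrib_left algebra_simps)
  then show ?case using z(1,2,3) w(1,2,3) ghost_add
    by (intro exI[of _ "z + w"] exI[of _ "F \<union> H"]) auto
next
  case (filt_cong N n x y)
  from filt_cong.IH obtain z F where z: "ghost n z" "finite F" "F \<subseteq> A"
    "\<And>F'. finite F' \<Longrightarrow> F \<subseteq> F' \<Longrightarrow> F' \<subseteq> A \<Longrightarrow> congr I (x - range_sum F' * x) (z - range_sum F' * z)"
    by auto
  have "congr I (y - range_sum F' * y) (z - range_sum F' * z)"
    if F': "finite F'" "F \<subseteq> F'" "F' \<subseteq> A" for F'
  proof -
    have "congr I (y - range_sum F' * y) (x - range_sum F' * x)"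
      using F' by (intro I_diff I_left I_sym[OF filt_cong(2)]) auto
    then show ?thesis using I_trans[OF _ z(4)[OF F']] by blast
  qed
  then show ?case using z(1,2,3) by (intro exI[of _ z] exI[of _ F]) auto
qed

text \<open>For \<open>N = 0\<close> the element is its own ghost part and
  \<open>left_unit_step\<close> applies with no edges. In the step, the elements
  \<open>gh e * x\<close> have shorter paths and supply the units that \<open>left_unit_step\<close>
  asks for.\<close>

lemma filt_left_unit:
  assumes J: "is_ideal J" "I \<subseteq> J"
  shows "filt N n x \<Longrightarrow> x \<in> J \<Longrightarrow> \<exists>u\<in>J. u * x - x \<in> I"
proof (induction N arbitrary: n x)
  case 0
  have z: "ghost n x" using filt_zero_ghost[OF 0(1)] by simp
  show ?case
    by (rule left_unit_step[OF J 0(2) _ z, of "{}"])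
      (use ghost_local_unit[OF z] ghost_closed[OF z] in \<open>auto simp: range_sum_def intro!: I_refl\<close>)
next
  case (Suc N)
  have xS: "x \<in> S" using filt_closed[OF Suc(2)] .
  from filt_decompose[OF Suc(2)] obtain z F where z: "ghost n z" and F: "finite F" "F \<subseteq> A"
    and "\<And>F'. finite F' \<Longrightarrow> F \<subseteq> F' \<Longrightarrow> F' \<subseteq> A \<Longrightarrow>
      congr I (x - range_sum F' * x) (z - range_sum F' * z)"
    by auto
  then have xz: "congr I (x - range_sum F * x) (z - range_sum F * z)" by simp
  have "has_local_unit (range_sum F * x)"
    unfolding range_sum_mult using F xS
    by (intro has_local_unit_sum has_local_unit_mult has_local_unit_ed) auto
  then have lu: "has_local_unit (x - range_sum F * x)"
    using has_local_unit_diff[OF filt_local_unit[OF Suc(2)]] by blast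
  show ?case
  proof (rule left_unit_step[OF J Suc(3) lu z F xz])
    fix e assume "e \<in> F"
    then have e: "e \<in> A" using F by blast
    have "filt N (n - 1) (gh e * x)" using filt_gh_left[OF Suc(2) e] by simp
    moreover have "gh e * x \<in> J" using ideal_mult_left[OF J(1) Suc(3)] e by simp
    ultimately show "\<exists>u\<in>J. u * (gh e * x) - gh e * x \<in> I" by (rule Suc(1))
  qed
qed

section \<open>Span of the products of a path and a ghost path\<close>

definition spanned :: "int \<Rightarrow> 'a \<Rightarrow> bool" where
  "spanned n x \<longleftrightarrow> (\<exists>N. filt N n x)"

lemma spanned_zero: "spanned n 0"
  using filt_ghost[OF ghost_zero] by (auto simp: spanned_def)

lemma spanned_add: "spanned n x \<Longrightarrow> spanned n y \<Longrightarrow> spanned n (x + y)"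
  unfolding spanned_def by (metis filt_add filt_mono max.cobounded1 max.cobounded2)

lemma spanned_ve: "v \<in> V \<Longrightarrow> spanned 0 (sc c * ve v)"
  unfolding spanned_def by (auto intro: filt_ghost ghost_ve)

lemma spanned_ve_left: "spanned n x \<Longrightarrow> v \<in> V \<Longrightarrow> spanned n (ve v * x)"
  and spanned_ed_left: "spanned n x \<Longrightarrow> e \<in> A \<Longrightarrow> spanned (1 + n) (ed e * x)"
  and spanned_gh_left: "spanned n x \<Longrightarrow> e \<in> A \<Longrightarrow> spanned (- 1 + n) (gh e * x)"
  unfolding spanned_def using filt_ve_left filt_ed filt_gh_left
  by (auto simp: add.commute) (metis add.commute uminus_add_conv_diff)+

lemma spanned_cong: "spanned n x \<Longrightarrow> congr I x y \<Longrightarrow> spanned n y"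
  unfolding spanned_def using filt_cong by blast

lemma spanned_ed: "e \<in> A \<Longrightarrow> spanned 1 (sc c * ed e)"
  using spanned_cong[OF spanned_ed_left[OF spanned_ve[of "rng e" c]], of e "sc c * ed e"]
    I_scale[OF ed_rng] by (simp add: sc_left)

lemma spanned_gh: "e \<in> A \<Longrightarrow> spanned (- 1) (sc c * gh e)"
  using spanned_cong[OF spanned_gh_left[OF spanned_ve[of "src e" c]], of e "sc c * gh e"]
    I_scale[OF gh_src] by (simp add: sc_left)

lemma spanned_left_unit:
  "is_ideal J \<Longrightarrow> I \<subseteq> J \<Longrightarrow> spanned n x \<Longrightarrow> x \<in> J \<Longrightarrow> \<exists>u\<in>J. u * x - x \<in> I"
  unfolding spanned_def using filt_left_unit by blast

end

section \<open>Ideals of a quotient algebra\<close>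

locale graded_quotient = graded_subring S part
  for S :: "'a::ring set" and part +
  fixes R :: "('k, 'a) module" and I :: "'a set"
  assumes carrier_R: "carrier R = S" and mult_R: "mult R = (*)" and add_R: "add R = (+)"
    and I: "is_ideal I" and graded_I: "graded I"
begin

definition Q :: "('k, 'a set) module" where "Q = quotient_algebra R I"

definition coset :: "'a \<Rightarrow> 'a set" where "coset f = I +>\<^bsub>R\<^esub> f"

definition preimage :: "'a set set \<Rightarrow> 'a set" where "preimage N = {f \<in> S. coset f \<in> N}"

lemma coset_eq: "coset f = {i + f | i. i \<in> I}"
  by (auto simp: coset_def a_r_coset_def' add_R)

lemma mem_coset_iff: "x \<in> coset f \<longleftrightarrow> x - f \<in> I"
  unfolding coset_eq by (auto intro: exI[of _ "x - f"])

lemma coset_self: "f \<in> coset f"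
  by (simp add: mem_coset_iff ideal_zero[OF I])

lemma coset_eq_iff: "coset f = coset g \<longleftrightarrow> f - g \<in> I"
proof
  assume "coset f = coset g"
  then show "f - g \<in> I" using coset_self[of f] mem_coset_iff by simp
next
  assume fg: "f - g \<in> I"
  have "x - f \<in> I \<longleftrightarrow> x - g \<in> I" for x
    using ideal_diff_left_iff[OF I, of "x - g" "x - f"] fg by simp
  then show "coset f = coset g" by (auto simp: mem_coset_iff)
qed

lemma coset_zero: "coset 0 = I"
  by (auto simp: mem_coset_iff)

lemma carrier_Q: "carrier Q = coset ` S"
  by (auto simp: Q_def quotient_algebra_def A_RCOSETS_def' carrier_R coset_def)

lemma zero_Q: "\<zero>\<^bsub>Q\<^esub> = coset 0"
  by (simp add: Q_def quotient_algebra_def coset_zero)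

lemma add_Q: "coset f \<oplus>\<^bsub>Q\<^esub> coset g = coset (f + g)"
proof -
  have "coset f \<oplus>\<^bsub>Q\<^esub> coset g = {x + y | x y. x \<in> coset f \<and> y \<in> coset g}"
    by (auto simp: Q_def quotient_algebra_def set_add_def' add_R)
  also have "\<dots> = coset (f + g)"
  proof (intro equalityI subsetI)
    fix z assume "z \<in> {x + y | x y. x \<in> coset f \<and> y \<in> coset g}"
    then obtain x y where "z = x + y" "x - f \<in> I" "y - g \<in> I" by (auto simp: mem_coset_iff)
    then show "z \<in> coset (f + g)"
      using ideal_add[OF I, of "x - f" "y - g"] by (simp add: mem_coset_iff algebra_simps)
  next
    fix z assume "z \<in> coset (f + g)"
    then have "z - g \<in> coset f" by (simp add: mem_coset_iff algebra_simps)
    then show "z \<in> {x + y | x y. x \<in> coset f \<and> y \<in> coset g}"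
      using coset_self[of g] by (intro CollectI exI[of _ "z - g"] exI[of _ g]) auto
  qed
  finally show ?thesis .
qed

text \<open>\<open>rcoset_mult\<close> is a union over all pairs of representatives, so it is a
  coset only because all these products give the same one.\<close>

lemma mult_Q:
  assumes f: "f \<in> S" and g: "g \<in> S"
  shows "coset f \<otimes>\<^bsub>Q\<^esub> coset g = coset (f * g)"
proof -
  have "coset (x * y) = coset (f * g)" if "x - f \<in> I" "y - g \<in> I" for x y
  proof -
    have "x \<in> S" using add_closed[OF ideal_subset[OF I that(1)] f] by simp
    have "x * y - f * g = x * (y - g) + (x - f) * g" by (simp add: algebra_simps)
    then show ?thesis
      using ideal_add[OF I ideal_mult_left[OF I that(2) \<open>x \<in> S\<close>] ideal_mult_right[OF I that(1) g]]
      by (simp add: coset_eq_iff)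
  qed
  moreover have "coset f \<otimes>\<^bsub>Q\<^esub> coset g = (\<Union>x\<in>coset f. \<Union>y\<in>coset g. coset (x * y))"
    by (simp add: Q_def quotient_algebra_def rcoset_mult_def mult_R coset_def)
  ultimately have "coset f \<otimes>\<^bsub>Q\<^esub> coset g = (\<Union>x\<in>coset f. \<Union>y\<in>coset g. coset (f * g))"
    by (simp add: mem_coset_iff)
  then show ?thesis using coset_self by blast
qed

lemma abelian_group_Q: "abelian_group Q"
proof (rule abelian_groupI)
  fix x assume "x \<in> carrier Q"
  then obtain f where f: "f \<in> S" "x = coset f" by (auto simp: carrier_Q)
  then show "\<exists>y\<in>carrier Q. y \<oplus>\<^bsub>Q\<^esub> x = \<zero>\<^bsub>Q\<^esub>"
    by (intro bexI[of _ "coset (- f)"]) (auto simp: add_Q zero_Q carrier_Q)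
qed (auto simp: carrier_Q add_Q zero_Q add.assoc add.left_commute add.commute[where 'a = 'a])

sublocale Q: abelian_group Q by (rule abelian_group_Q)

lemma a_inv_Q: "f \<in> S \<Longrightarrow> \<ominus>\<^bsub>Q\<^esub> coset f = coset (- f)"
  by (rule Q.minus_equality) (auto simp: add_Q zero_Q carrier_Q)

section \<open>Correspondence between ideals of the quotient and ideals above
  \<open>I\<close>\<close>

lemma additive_subgroup_Q_iff:
  "additive_subgroup N Q \<longleftrightarrow> N \<subseteq> carrier Q \<and> 0 \<in> preimage N \<and>
     (\<forall>f\<in>preimage N. \<forall>g\<in>preimage N. f - g \<in> preimage N)" (is "?L \<longleftrightarrow> ?R")
proof
  assume ?L
  then interpret N: additive_subgroup N Q .
  have "f - g \<in> preimage N" if f: "f \<in> preimage N" and g: "g \<in> preimage N" for f g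
  proof -
    have "coset f \<oplus>\<^bsub>Q\<^esub> (\<ominus>\<^bsub>Q\<^esub> coset g) \<in> N"
      using f g by (intro N.a_closed N.a_inv_closed) (auto simp: preimage_def)
    then show ?thesis using f g by (simp add: preimage_def a_inv_Q add_Q)
  qed
  moreover have "0 \<in> preimage N" using N.zero_closed by (simp add: preimage_def zero_Q)
  ultimately show ?R using N.a_subset by blast
next
  assume R: ?R
  have rep: "\<exists>f\<in>preimage N. x = coset f" if "x \<in> N" for x
    using that R by (auto simp: carrier_Q preimage_def)
  have neg: "- f \<in> preimage N" if "f \<in> preimage N" for f
    using R that by (metis diff_0)
  show ?L
  proof (rule additive_subgroupI, rule subgroup.intro)
    show "N \<subseteq> carrier (add_monoid Q)" using R by simp
    show "\<one>\<^bsub>add_monoid Q\<^esub> \<in> N" using R by (simp add: zero_Q preimage_def)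
    fix x assume "x \<in> N"
    then obtain f where f: "f \<in> preimage N" "x = coset f" using rep by blast
    have "\<ominus>\<^bsub>Q\<^esub> x \<in> N" using neg[OF f(1)] f by (simp add: preimage_def a_inv_Q)
    then show "inv\<^bsub>add_monoid Q\<^esub> x \<in> N" by (simp add: a_inv_def)
    fix y assume "y \<in> N"
    then obtain g where g: "g \<in> preimage N" "y = coset g" using rep by blast
    have "f - (- g) \<in> preimage N" using R f(1) neg[OF g(1)] by blast
    then show "x \<otimes>\<^bsub>add_monoid Q\<^esub> y \<in> N" using f g by (simp add: preimage_def add_Q)
  qed
qed

text \<open>The inclusion in the carrier is stated separately, since \<open>preimage\<close> does
  not see members of \<open>N\<close> that are not cosets of elements of \<open>S\<close>.\<close>

lemma two_sided_ideal_Q_iff: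
  "two_sided_ideal N Q \<longleftrightarrow> N \<subseteq> carrier Q \<and> is_ideal (preimage N)"
proof -
  have "(\<forall>x\<in>N. \<forall>a\<in>carrier Q. a \<otimes>\<^bsub>Q\<^esub> x \<in> N \<and> x \<otimes>\<^bsub>Q\<^esub> a \<in> N) \<longleftrightarrow>
      (\<forall>f\<in>preimage N. \<forall>a\<in>S. a * f \<in> preimage N \<and> f * a \<in> preimage N)"
    if "N \<subseteq> carrier Q"
  proof -
    have ball: "(\<forall>x\<in>N. \<forall>a\<in>carrier Q. T a x) \<longleftrightarrow> (\<forall>f\<in>preimage N. \<forall>a\<in>S. T (coset a) (coset f))"
      for T :: "'a set \<Rightarrow> 'a set \<Rightarrow> bool"
      using that unfolding carrier_Q preimage_def by blast
    have "coset a \<otimes>\<^bsub>Q\<^esub> coset f \<in> N \<longleftrightarrow> a * f \<in> preimage N"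
      "coset f \<otimes>\<^bsub>Q\<^esub> coset a \<in> N \<longleftrightarrow> f * a \<in> preimage N"
      if "f \<in> preimage N" "a \<in> S" for a f
      using that by (simp_all add: preimage_def mult_Q)
    then show ?thesis unfolding ball by auto
  qed
  moreover have "preimage N \<subseteq> S" by (auto simp: preimage_def)
  ultimately show ?thesis
    unfolding two_sided_ideal_def additive_subgroup_Q_iff is_ideal_def by blast
qed

lemma preimage_image:
  assumes "is_ideal P" "I \<subseteq> P"
  shows "preimage (coset ` P) = P"
proof (intro equalityI subsetI)
  fix f assume "f \<in> preimage (coset ` P)"
  then obtain p where "p \<in> P" "f - p \<in> I" by (auto simp: preimage_def coset_eq_iff)
  then show "f \<in> P" using ideal_diff_left_iff[OF assms(1), of f p] assms(2) by blast
qed (use ideal_subset[OF assms(1)] in \<open>auto simp: preimage_def\<close>)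

lemma image_preimage: "N \<subseteq> carrier Q \<Longrightarrow> coset ` preimage N = N"
  by (auto simp: carrier_Q preimage_def)

lemma preimage_superset:
  assumes "0 \<in> preimage N"
  shows "I \<subseteq> preimage N"
proof
  fix x assume x: "x \<in> I"
  then have "coset x = coset 0" by (simp add: coset_eq_iff)
  then show "x \<in> preimage N" using assms ideal_subset[OF I x] by (simp add: preimage_def)
qed

lemma proper_ideal_image:
  assumes P: "is_ideal P" "I \<subseteq> P" "P \<noteq> S"
  shows "proper_ideal (coset ` P) Q"
proof -
  have "coset ` P \<noteq> carrier Q"
  proof
    assume "coset ` P = carrier Q"
    then have "preimage (coset ` P) = S" by (auto simp: preimage_def carrier_Q)
    then show False using preimage_image[OF P(1,2)] P(3) by simp
  qed
  then show ?thesis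
    using P ideal_subset[OF P(1)]
    by (auto simp: proper_ideal_def two_sided_ideal_Q_iff preimage_image carrier_Q)
qed

lemma proper_ideal_preimage:
  assumes "proper_ideal N Q"
  shows "is_ideal (preimage N)" "I \<subseteq> preimage N" "preimage N \<noteq> S" "coset ` preimage N = N"
proof -
  have N: "N \<subseteq> carrier Q" "is_ideal (preimage N)" "N \<noteq> carrier Q"
    using assms by (auto simp: proper_ideal_def two_sided_ideal_Q_iff)
  show "is_ideal (preimage N)" by (rule N)
  show "I \<subseteq> preimage N" by (rule preimage_superset[OF ideal_zero[OF N(2)]])
  show img: "coset ` preimage N = N" by (rule image_preimage[OF N(1)])
  show "preimage N \<noteq> S" using img N(3) by (auto simp: carrier_Q)
qed

lemma maximal_over_preimage:
  assumes M: "maximal_ideal M Q"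
  shows "maximal_over I (preimage M)"
proof -
  have M': "proper_ideal M Q" and max: "\<And>N. proper_ideal N Q \<Longrightarrow> M \<subseteq> N \<Longrightarrow> N = M"
    using M by (auto simp: maximal_ideal_def)
  note pre = proper_ideal_preimage[OF M']
  show ?thesis
    unfolding maximal_over_def
  proof (intro conjI allI impI pre)
    fix P assume P: "is_ideal P" "preimage M \<subseteq> P" "P \<noteq> S"
    have IP: "I \<subseteq> P" using pre(2) P(2) by blast
    have "M \<subseteq> coset ` P" using pre(4) P(2) by blast
    then have "coset ` P = M" using max proper_ideal_image[OF P(1) IP P(3)] by blast
    then show "P = preimage M" using preimage_image[OF P(1) IP] by simp
  qed
qed

lemma maximal_ideal_image:
  assumes P: "maximal_over I P"
  shows "maximal_ideal (coset ` P) Q"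
proof -
  have P': "is_ideal P" "I \<subseteq> P" "P \<noteq> S"
    and max: "\<And>P'. is_ideal P' \<Longrightarrow> P \<subseteq> P' \<Longrightarrow> P' \<noteq> S \<Longrightarrow> P' = P"
    using P by (auto simp: maximal_over_def)
  show ?thesis
    unfolding maximal_ideal_def
  proof (intro conjI allI impI)
    show "proper_ideal (coset ` P) Q" by (rule proper_ideal_image[OF P'])
    fix N assume "proper_ideal N Q \<and> coset ` P \<subseteq> N"
    then have N: "proper_ideal N Q" "coset ` P \<subseteq> N" by auto
    have "P \<subseteq> preimage N" using N(2) ideal_subset[OF P'(1)] by (auto simp: preimage_def)
    then have "preimage N = P"
      by (rule max[OF proper_ideal_preimage(1)[OF N(1)] _ proper_ideal_preimage(3)[OF N(1)]])
    then show "N = coset ` P" using proper_ideal_preimage(4)[OF N(1)] by simp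
  qed
qed

section \<open>Decomposition into homogeneous components\<close>

lemma finsum_coset:
  assumes "finite N" "\<And>i. i \<in> N \<Longrightarrow> f i \<in> S"
  shows "(\<Oplus>\<^bsub>Q\<^esub>i\<in>N. coset (f i)) = coset (\<Sum>i\<in>N. f i)"
  using assms
proof (induction N rule: finite_induct)
  case empty
  then show ?case by (simp add: zero_Q)
next
  case (insert j N)
  then show ?case by (subst Q.finsum_insert) (auto simp: carrier_Q add_Q)
qed

definition component :: "int \<Rightarrow> 'a set set" where
  "component n = coset ` {f \<in> S. part n f = f}"

lemma preimage_component:
  assumes M: "M \<subseteq> carrier Q"
  shows "f \<in> preimage (M \<inter> component n) \<longleftrightarrow> f \<in> preimage M \<and> (\<exists>g\<in>S. part n g = g \<and> f - g \<in> I)"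
  by (auto simp: preimage_def component_def coset_eq_iff)

text \<open>Spanning rests on the gradedness of \<open>preimage M\<close>. Independence rests on
  that of \<open>I\<close>: if homogeneous representatives of distinct degrees have their sum in
  \<open>I\<close>, each of them is a part of that sum.\<close>

lemma graded_ideal_Q:
  assumes M: "two_sided_ideal M Q" and graded: "graded (preimage M)"
  shows "graded_ideal Q component M"
proof -
  have MQ: "M \<subseteq> carrier Q" and P: "is_ideal (preimage M)"
    using M by (auto simp: two_sided_ideal_Q_iff)
  have sub: "additive_subgroup (M \<inter> component n) Q" for n
    unfolding additive_subgroup_Q_iff
  proof (intro conjI ballI)
    show "M \<inter> component n \<subseteq> carrier Q" using MQ by blast
    show "0 \<in> preimage (M \<inter> component n)"
      unfolding preimage_component[OF MQ] using ideal_zero[OF P] ideal_zero[OF I]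
      by (intro conjI bexI[of _ 0]) auto
    fix f f' assume "f \<in> preimage (M \<inter> component n)" "f' \<in> preimage (M \<inter> component n)"
    then obtain g g' where f: "f \<in> preimage M" "f' \<in> preimage M"
      and g: "g \<in> S" "part n g = g" "f - g \<in> I" "g' \<in> S" "part n g' = g'" "f' - g' \<in> I"
      unfolding preimage_component[OF MQ] by blast
    have "(f - f') - (g - g') \<in> I"
      using ideal_diff[OF I g(3,6)] by (simp add: algebra_simps)
    then show "f - f' \<in> preimage (M \<inter> component n)"
      unfolding preimage_component[OF MQ] using ideal_diff[OF P f] g
      by (intro conjI bexI[of _ "g - g'"]) (auto simp: part_diff)
  qed
  have rep: "\<exists>f. \<forall>i\<in>N. f i \<in> preimage M \<and> part i (f i) = f i \<and> x i = coset (f i)"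
    if "\<forall>i\<in>N. x i \<in> M \<inter> component i" for N x
  proof (rule bchoice, rule ballI)
    fix i assume "i \<in> N"
    then have "x i \<in> M" "x i \<in> component i" using that by auto
    then show "\<exists>f. f \<in> preimage M \<and> part i f = f \<and> x i = coset f"
      by (auto simp: component_def preimage_def)
  qed
  have sum: "M = {\<Oplus>\<^bsub>Q\<^esub>i\<in>N. x i | N x. finite N \<and> (\<forall>i\<in>N. x i \<in> M \<inter> component i)}" (is "M = ?D")
  proof (intro equalityI subsetI)
    fix X assume "X \<in> M"
    then obtain f where f: "f \<in> preimage M" "X = coset f" using image_preimage[OF MQ] by blast
    have fS: "f \<in> S" using f by (simp add: preimage_def)
    define N where "N = {n. part n f \<noteq> 0}"
    have "X = (\<Oplus>\<^bsub>Q\<^esub>i\<in>N. coset (part i f))"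
      using fS f(2) sum_parts[of f] finite_parts[of f] by (subst finsum_coset) (auto simp: N_def)
    moreover have "\<forall>i\<in>N. coset (part i f) \<in> M \<inter> component i"
      using f(1) graded fS by (auto simp: graded_def preimage_def component_def part_part)
    moreover have "finite N" unfolding N_def by (rule finite_parts)
    ultimately show "X \<in> ?D" by blast
  next
    fix X assume "X \<in> ?D"
    then obtain N x where N: "finite N" and x: "\<forall>i\<in>N. x i \<in> M \<inter> component i"
      and X: "X = (\<Oplus>\<^bsub>Q\<^esub>i\<in>N. x i)"
      by blast
    obtain f where f: "\<forall>i\<in>N. f i \<in> preimage M \<and> part i (f i) = f i \<and> x i = coset (f i)"
      using rep[OF x] by blast
    have "X = (\<Oplus>\<^bsub>Q\<^esub>i\<in>N. coset (f i))"
      unfolding X using f by (intro Q.finsum_cong') (auto simp: carrier_Q preimage_def)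
    also have "\<dots> = coset (\<Sum>i\<in>N. f i)"
      using f by (intro finsum_coset N) (auto simp: preimage_def)
    also have "\<dots> \<in> M" using ideal_sum[OF P, of N f] f by (simp add: preimage_def)
    finally show "X \<in> M" .
  qed
  have indep: "\<forall>i\<in>N. x i = \<zero>\<^bsub>Q\<^esub>"
    if N: "finite N" "\<forall>i\<in>N. x i \<in> M \<inter> component i" "(\<Oplus>\<^bsub>Q\<^esub>i\<in>N. x i) = \<zero>\<^bsub>Q\<^esub>" for N x
  proof
    fix j assume j: "j \<in> N"
    obtain f where f: "\<forall>i\<in>N. f i \<in> preimage M \<and> part i (f i) = f i \<and> x i = coset (f i)"
      using rep[OF N(2)] by blast
    have "(\<Oplus>\<^bsub>Q\<^esub>i\<in>N. x i) = (\<Oplus>\<^bsub>Q\<^esub>i\<in>N. coset (f i))"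
      using f by (intro Q.finsum_cong') (auto simp: carrier_Q preimage_def)
    also have "\<dots> = coset (\<Sum>i\<in>N. f i)"
      using f by (intro finsum_coset N) (auto simp: preimage_def)
    finally have "coset (\<Sum>i\<in>N. f i) = coset 0" using N(3) by (simp add: zero_Q)
    then have "(\<Sum>i\<in>N. f i) \<in> I" unfolding coset_eq_iff by simp
    then have "part j (\<Sum>i\<in>N. f i) \<in> I" using graded_I by (simp add: graded_def)
    also have "part j (\<Sum>i\<in>N. f i) = (\<Sum>i\<in>N. if i = j then f i else 0)"
      unfolding part_sum
    proof (intro sum.cong refl)
      fix i assume "i \<in> N"
      then have "part i (f i) = f i" using f by blast
      then show "part j (f i) = (if i = j then f i else 0)"
        using part_homogeneous[of i "f i" j] by auto
    qed
    also have "\<dots> = f j" using N(1) j by simp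
    finally show "x j = \<zero>\<^bsub>Q\<^esub>" using f j by (simp add: zero_Q coset_eq_iff)
  qed
  show ?thesis
    unfolding graded_ideal_def internal_direct_sum_def
  proof (intro conjI allI impI)
    show "\<forall>i\<in>N. x i = \<zero>\<^bsub>Q\<^esub>"
      if "finite N \<and> (\<forall>i\<in>N. x i \<in> M \<inter> component i) \<and> (\<Oplus>\<^bsub>Q\<^esub>i\<in>N. x i) = \<zero>\<^bsub>Q\<^esub>" for N x
      using that by (elim conjE) (rule indep)
  qed (rule M sub sum)+
qed

end

section \<open>Leavitt path algebras\<close>

definition hom_part ::
  "int \<Rightarrow> (('v, 'e) generator list \<Rightarrow>\<^sub>0 'k::field) \<Rightarrow> ('v, 'e) generator list \<Rightarrow>\<^sub>0 'k" where
  "hom_part n f = Poly_Mapping.mapp (\<lambda>w c. if word_degree w = n then c else 0) f"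

lemma lookup_hom_part:
  "Poly_Mapping.lookup (hom_part n f) w = (if word_degree w = n then Poly_Mapping.lookup f w else 0)"
  by (auto simp: hom_part_def lookup_mapp when_def in_keys_iff)

lemma word_degree_append: "word_degree (v + w) = word_degree v + word_degree w"
  by (simp add: word_degree_def plus_list_def)

lemma hom_part_eq_iff: "hom_part n f = f \<longleftrightarrow> (\<forall>w\<in>Poly_Mapping.keys f. word_degree w = n)"
  by (auto simp: poly_mapping_eq_iff fun_eq_iff lookup_hom_part in_keys_iff)

lemma hom_part_mult:
  assumes "hom_part m f = f" "hom_part n g = g"
  shows "hom_part (m + n) (f * g) = f * g"
  using assms keys_mult[of f g] unfolding hom_part_eq_iff by (fastforce simp: word_degree_append)

lemma hom_part_add: "hom_part n (f + g) = hom_part n f + hom_part n g"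
  by (rule poly_mapping_eqI) (simp add: lookup_hom_part lookup_add)

lemma hom_part_diff: "hom_part n (f - g) = hom_part n f - hom_part n g"
  by (rule poly_mapping_eqI) (simp add: lookup_hom_part lookup_minus)

lemma hom_part_hom_part: "hom_part m (hom_part n f) = (if m = n then hom_part n f else 0)"
  by (rule poly_mapping_eqI) (simp add: lookup_hom_part)

lemma carrier_free_algebra:
  "carrier (free_algebra X) = {f. \<forall>w\<in>Poly_Mapping.keys f. w \<noteq> [] \<and> set w \<subseteq> X}"
  by (simp add: free_algebra_def)

lemma graded_subring_free_algebra:
  "graded_subring (carrier (free_algebra X)) (hom_part :: int \<Rightarrow> _ \<Rightarrow> ('v, 'e) generator list \<Rightarrow>\<^sub>0 'k::field)"
proof
  show "0 \<in> carrier (free_algebra X)" by (simp add: carrier_free_algebra)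
next
  fix f g :: "('v, 'e) generator list \<Rightarrow>\<^sub>0 'k"
  assume fg: "f \<in> carrier (free_algebra X)" "g \<in> carrier (free_algebra X)"
  then show "f - g \<in> carrier (free_algebra X)"
    using keys_diff[of f g] by (auto simp: carrier_free_algebra)
  show "f * g \<in> carrier (free_algebra X)"
    using fg keys_mult[of f g] by (fastforce simp: carrier_free_algebra plus_list_def)
next
  fix f :: "('v, 'e) generator list \<Rightarrow>\<^sub>0 'k" and n
  assume "f \<in> carrier (free_algebra X)"
  then show "hom_part n f \<in> carrier (free_algebra X)"
    by (auto simp: carrier_free_algebra in_keys_iff lookup_hom_part split: if_splits)
next
  fix f :: "('v, 'e) generator list \<Rightarrow>\<^sub>0 'k"
  have sub: "{n. hom_part n f \<noteq> 0} \<subseteq> word_degree ` Poly_Mapping.keys f"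
    by (auto simp: poly_mapping_eq_iff fun_eq_iff lookup_hom_part in_keys_iff)
  then show fin: "finite {n. hom_part n f \<noteq> 0}" by (rule finite_subset) simp
  show "(\<Sum>n | hom_part n f \<noteq> 0. hom_part n f) = f"
  proof (rule poly_mapping_eqI)
    fix w
    have "Poly_Mapping.lookup f w = 0" if "hom_part (word_degree w) f = 0"
      using that lookup_hom_part[of "word_degree w" f w] by simp
    then show "Poly_Mapping.lookup (\<Sum>n | hom_part n f \<noteq> 0. hom_part n f) w = Poly_Mapping.lookup f w"
      using fin by (auto simp: lookup_sum lookup_hom_part)
  qed
next
  fix m n and f g :: "('v, 'e) generator list \<Rightarrow>\<^sub>0 'k"
  show "hom_part (m + n) (hom_part m f * hom_part n g) = hom_part m f * hom_part n g"
    by (rule hom_part_mult) (simp_all add: hom_part_hom_part)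
qed (simp_all add: hom_part_add hom_part_hom_part)

section \<open>Scalars and letters in the free algebra\<close>

definition scalar :: "'k \<Rightarrow> 'x list \<Rightarrow>\<^sub>0 'k::field" where
  "scalar c = Poly_Mapping.single [] c"

text \<open>Turns scalar multiplication into ring multiplication by a multiple of the empty word,
  which belongs to the ring of all noncommutative polynomials.\<close>

lemma smult_free_algebra: "c \<odot>\<^bsub>free_algebra X\<^esub> f = scalar c * f"
  by (simp add: free_algebra_def scalar_def mult_map_scale_conv_mult zero_list_def)

lemma poly_mapping_sum_single:
  "(\<Sum>w\<in>Poly_Mapping.keys f. Poly_Mapping.single w (Poly_Mapping.lookup f w)) = f"
proof (rule poly_mapping_eqI)
  fix v
  have "Poly_Mapping.lookup (\<Sum>w\<in>Poly_Mapping.keys f. Poly_Mapping.single w (Poly_Mapping.lookup f w)) v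
      = (\<Sum>w\<in>Poly_Mapping.keys f. if w = v then Poly_Mapping.lookup f v else 0)"
    unfolding lookup_sum by (rule sum.cong) (auto simp: lookup_single when_def)
  then show "Poly_Mapping.lookup (\<Sum>w\<in>Poly_Mapping.keys f. Poly_Mapping.single w (Poly_Mapping.lookup f w)) v
      = Poly_Mapping.lookup f v"
    by (simp add: in_keys_iff)
qed

lemma scalar_mult_single: "scalar c * Poly_Mapping.single w d = Poly_Mapping.single w (c * d)"
  by (simp add: scalar_def mult_single plus_list_def)

lemma scalar_comm: "scalar c * f = f * scalar c"
proof -
  have comm: "scalar c * Poly_Mapping.single w d = Poly_Mapping.single w d * scalar c" for w d
    by (simp add: scalar_def mult_single plus_list_def mult.commute)
  have "scalar c * (\<Sum>w\<in>Poly_Mapping.keys f. Poly_Mapping.single w (Poly_Mapping.lookup f w)) =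
      (\<Sum>w\<in>Poly_Mapping.keys f. Poly_Mapping.single w (Poly_Mapping.lookup f w)) * scalar c"
    unfolding sum_distrib_left sum_distrib_right by (rule sum.cong[OF refl comm])
  then show ?thesis unfolding poly_mapping_sum_single .
qed

lemma lookup_scalar_mult: "Poly_Mapping.lookup (scalar c * f) w = c * Poly_Mapping.lookup f w"
proof -
  have "scalar c * f = Poly_Mapping.map ((*) c) f"
    by (simp add: scalar_def mult_map_scale_conv_mult zero_list_def)
  then show ?thesis by (simp add: Poly_Mapping.map.rep_eq when_def)
qed

lemma scalar_closed:
  "f \<in> carrier (free_algebra X) \<Longrightarrow> scalar c * f \<in> carrier (free_algebra X)"
  by (auto simp: carrier_free_algebra in_keys_iff lookup_scalar_mult)

lemma hom_part_scalar: "hom_part n (scalar c * f) = scalar c * hom_part n f"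
  by (rule poly_mapping_eqI) (simp add: lookup_hom_part lookup_scalar_mult)

lemma scalar_one: "scalar 1 = 1"
  by (simp add: scalar_def flip: zero_list_def)

lemma scalar_add: "scalar (a + b) = scalar a + scalar b"
  by (simp add: scalar_def single_add)

lemma scalar_mult: "scalar (a * b) = scalar a * scalar b"
  by (simp add: scalar_def mult_single plus_list_def)

lemma letter_closed: "x \<in> X \<Longrightarrow> letter x \<in> carrier (free_algebra X)"
  by (simp add: letter_def carrier_free_algebra)

lemma hom_part_letter: "hom_part n (letter x) = (if n = generator_degree x then letter x else 0)"
  by (rule poly_mapping_eqI)
    (auto simp: lookup_hom_part letter_def lookup_single when_def word_degree_def)

lemma single_Cons: "Poly_Mapping.single (x # w) c = letter x * Poly_Mapping.single w c"
  by (simp add: letter_def mult_single plus_list_def)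

lemma single_singleton: "Poly_Mapping.single [x] c = scalar c * letter x"
  by (simp add: letter_def scalar_mult_single)

lemma additive_subgroup_free_algebra_iff:
  fixes H :: "(('v, 'e) generator list \<Rightarrow>\<^sub>0 'k::field) set"
  shows "additive_subgroup H (free_algebra X) \<longleftrightarrow>
     H \<subseteq> carrier (free_algebra X) \<and> 0 \<in> H \<and> (\<forall>f\<in>H. \<forall>g\<in>H. f - g \<in> H)" (is "?L \<longleftrightarrow> ?R")
proof -
  let ?F = "free_algebra X :: ('k, ('v, 'e) generator list \<Rightarrow>\<^sub>0 'k) module"
  interpret graded_subring "carrier ?F" hom_part by (rule graded_subring_free_algebra)
  have ops: "\<zero>\<^bsub>?F\<^esub> = 0" "f \<oplus>\<^bsub>?F\<^esub> g = f + g" for f g by (simp_all add: free_algebra_def)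
  interpret F: abelian_group ?F
  proof (rule abelian_groupI)
    fix f assume "f \<in> carrier ?F"
    then show "\<exists>g\<in>carrier ?F. g \<oplus>\<^bsub>?F\<^esub> f = \<zero>\<^bsub>?F\<^esub>"
      by (intro bexI[of _ "- f"]) (simp_all add: ops)
  qed (simp_all add: ops ac_simps)
  have neg: "\<ominus>\<^bsub>?F\<^esub> f = - f" if "f \<in> carrier ?F" for f
    using that by (intro F.minus_equality) (simp_all add: ops)
  show ?thesis
  proof
    assume ?L
    then interpret H: additive_subgroup H ?F .
    have "f - g \<in> H" if "f \<in> H" "g \<in> H" for f g
      using H.a_closed[OF that(1) H.a_inv_closed[OF that(2)]] neg that(2) H.a_subset
      by (auto simp: ops)
    then show ?R using H.a_subset H.zero_closed by (simp add: ops)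
  next
    assume R: ?R
    have minus: "- f \<in> H" if "f \<in> H" for f using R that by (metis diff_0)
    have plus: "f + g \<in> H" if "f \<in> H" "g \<in> H" for f g
      using R minus that by (metis diff_minus_eq_add)
    have "inv\<^bsub>add_monoid ?F\<^esub> f \<in> H" if "f \<in> H" for f
      using minus[OF that] neg[of f] R that by (auto simp: a_inv_def)
    then show ?L
      using R plus by (intro additive_subgroupI subgroup.intro) (auto simp: ops)
  qed
qed

lemma mult_free_algebra: "f \<otimes>\<^bsub>free_algebra X\<^esub> g = f * g"
  by (simp add: free_algebra_def)

lemma two_sided_ideal_free_algebra_iff:
  fixes I :: "(('v, 'e) generator list \<Rightarrow>\<^sub>0 'k::field) set"
  shows "two_sided_ideal I (free_algebra X) \<longleftrightarrow> graded_subring.is_ideal (carrier (free_algebra X)) I"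
  unfolding two_sided_ideal_def additive_subgroup_free_algebra_iff mult_free_algebra
    graded_subring.is_ideal_def[OF graded_subring_free_algebra]
  by auto

section \<open>The ideal of relations and its Leavitt family\<close>

context
  fixes G :: "('v, 'e) pre_digraph" and S :: "(('v, 'e) generator list \<Rightarrow>\<^sub>0 'k::field) set"
    and I :: "(('v, 'e) generator list \<Rightarrow>\<^sub>0 'k) set"
  assumes wf: "wf_digraph G"
  defines "S \<equiv> carrier (free_algebra (generators G))"
    and "I \<equiv> leavitt_ideal G"
begin

interpretation graded_subring S hom_part
  unfolding S_def by (rule graded_subring_free_algebra)

lemma tail_head: "e \<in> arcs G \<Longrightarrow> tail G e \<in> verts G" "e \<in> arcs G \<Longrightarrow> head G e \<in> verts G"
  using wf by (auto simp: wf_digraph_def)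

lemma letter_in_S:
  "v \<in> verts G \<Longrightarrow> letter (Vertex v) \<in> S"
  "e \<in> arcs G \<Longrightarrow> letter (Edge e) \<in> S"
  "e \<in> arcs G \<Longrightarrow> letter (Ghost e) \<in> S"
  unfolding S_def by (intro letter_closed; simp add: generators_def)+

lemma scalar_S: "x \<in> S \<Longrightarrow> scalar c * x \<in> S"
  unfolding S_def by (rule scalar_closed)

lemma relation_closed: "r \<in> leavitt_relations G \<Longrightarrow> r \<in> S"
  unfolding leavitt_relations_def
  by (auto intro!: diff_closed mult_closed sum_closed letter_in_S tail_head simp: regular_def)

lemma relation_homogeneous:
  fixes r :: "('v, 'e) generator list \<Rightarrow>\<^sub>0 'k"
  assumes "r \<in> leavitt_relations G"
  shows "\<exists>n. hom_part n r = r"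
proof -
  have 0: "hom_part 0 (letter (Vertex v)) = letter (Vertex v)"
    and 1: "hom_part 1 (letter (Edge e)) = letter (Edge e)"
    and m1: "hom_part (-1) (letter (Ghost e)) = letter (Ghost e)" for v e
    by (simp_all add: hom_part_letter)
  have "hom_part 0 (letter (Vertex v) * letter (Vertex w)) = letter (Vertex v) * letter (Vertex w)"
    "hom_part 1 (letter (Vertex v) * letter (Edge e)) = letter (Vertex v) * letter (Edge e)"
    "hom_part 1 (letter (Edge e) * letter (Vertex v)) = letter (Edge e) * letter (Vertex v)"
    "hom_part (-1) (letter (Vertex v) * letter (Ghost e)) = letter (Vertex v) * letter (Ghost e)"
    "hom_part (-1) (letter (Ghost e) * letter (Vertex v)) = letter (Ghost e) * letter (Vertex v)"
    "hom_part 0 (letter (Ghost e) * letter (Edge f)) = letter (Ghost e) * letter (Edge f)"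
    "hom_part 0 (letter (Edge e) * letter (Ghost f)) = letter (Edge e) * letter (Ghost f)" for v w e f
    using hom_part_mult[OF 0 0, of v w] hom_part_mult[OF 0 1, of v e] hom_part_mult[OF 1 0, of e v]
      hom_part_mult[OF 0 m1, of v e] hom_part_mult[OF m1 0, of e v] hom_part_mult[OF m1 1, of e f]
      hom_part_mult[OF 1 m1, of e f]
    by simp_all
  note mult = this
  have "hom_part 0 r = r \<or> hom_part 1 r = r \<or> hom_part (-1) r = r"
    using assms unfolding leavitt_relations_def
    by (auto simp: hom_part_diff part_sum mult 0 1 m1)
  then show ?thesis by blast
qed

lemma algebra_ideal_iff:
  "algebra_ideal P (free_algebra (generators G)) \<longleftrightarrow> is_ideal P \<and> (\<forall>c. \<forall>x\<in>P. scalar c * x \<in> P)"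
  by (simp add: algebra_ideal_def two_sided_ideal_free_algebra_iff smult_free_algebra S_def)

lemma I_least: "is_ideal P \<Longrightarrow> (\<And>c x. x \<in> P \<Longrightarrow> scalar c * x \<in> P) \<Longrightarrow> leavitt_relations G \<subseteq> P \<Longrightarrow> I \<subseteq> P"
  unfolding I_def leavitt_ideal_def generated_algebra_ideal_def by (auto simp: algebra_ideal_iff)

lemma relations_subset: "leavitt_relations G \<subseteq> I"
  unfolding I_def leavitt_ideal_def generated_algebra_ideal_def by blast

text \<open>Makes \<open>S\<close> one of the ideals whose intersection is \<open>I\<close>, which
  bounds \<open>I\<close> by \<open>S\<close>.\<close>

lemma is_ideal_S: "is_ideal S"
  by (rule is_idealI) auto

lemma is_ideal_I: "is_ideal I"
proof (rule is_idealI)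
  show "I \<subseteq> S"
    using relation_closed by (intro I_least is_ideal_S) (auto simp: S_def intro: scalar_closed)
qed (auto simp: I_def leavitt_ideal_def generated_algebra_ideal_def algebra_ideal_iff S_def[symmetric]
    intro: ideal_zero ideal_diff ideal_mult_left ideal_mult_right)

lemma scalar_I: "x \<in> I \<Longrightarrow> scalar c * x \<in> I"
  by (auto simp: I_def leavitt_ideal_def generated_algebra_ideal_def algebra_ideal_iff)

text \<open>The core of \<open>I\<close> is an algebra ideal and contains the relations, as these
  are homogeneous; by minimality it is all of \<open>I\<close>.\<close>

lemma graded_I: "graded I"
proof -
  have "I \<subseteq> core I"
  proof (rule I_least[OF is_ideal_core[OF is_ideal_I]])
    show "scalar c * x \<in> core I" if "x \<in> core I" for c x
      using that scalar_I by (auto simp: core_def hom_part_scalar)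
    show "leavitt_relations G \<subseteq> core I"
    proof
      fix r :: "('v, 'e) generator list \<Rightarrow>\<^sub>0 'k"
      assume r: "r \<in> leavitt_relations G"
      then obtain n where "hom_part n r = r" using relation_homogeneous by blast
      then show "r \<in> core I"
        using relations_subset r ideal_zero[OF is_ideal_I] part_homogeneous[of n r]
        by (auto simp: core_def)
    qed
  qed
  then have "core I = I" using core_subset[of I] by blast
  then show ?thesis using graded_core[OF is_ideal_I] by simp
qed

lemma congr_relation: "x - y \<in> leavitt_relations G \<Longrightarrow> x \<in> S \<Longrightarrow> y \<in> S \<Longrightarrow> congr I x y"
  using relations_subset by (auto simp: congr_def)

interpretation leavitt_family S hom_part I scalar "verts G" "arcs G" "tail G" "head G"
  "\<lambda>v. letter (Vertex v)" "\<lambda>e. letter (Edge e)" "\<lambda>e. letter (Ghost e)"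
proof
  fix v w e f
  { assume "v \<in> verts G" "w \<in> verts G"
    then show "congr I (letter (Vertex v) * letter (Vertex w)) (if v = w then letter (Vertex v) else 0)"
      by (intro congr_relation) (auto simp: leavitt_relations_def letter_in_S) }
  assume e: "e \<in> arcs G"
  then show "congr I (letter (Vertex (tail G e)) * letter (Edge e)) (letter (Edge e))"
    "congr I (letter (Edge e) * letter (Vertex (head G e))) (letter (Edge e))"
    "congr I (letter (Vertex (head G e)) * letter (Ghost e)) (letter (Ghost e))"
    "congr I (letter (Ghost e) * letter (Vertex (tail G e))) (letter (Ghost e))"
    by (intro congr_relation; auto simp: leavitt_relations_def letter_in_S tail_head)+
  assume "f \<in> arcs G"
  then show "congr I (letter (Ghost e) * letter (Edge f)) (if e = f then letter (Vertex (head G e)) else 0)"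
    using e by (intro congr_relation) (auto simp: leavitt_relations_def letter_in_S tail_head)
qed (use is_ideal_I scalar_I scalar_S letter_in_S tail_head scalar_comm
    in \<open>auto simp: scalar_one scalar_add scalar_mult\<close>)

text \<open>Words are built by putting letters in front, so stability under left multiplication
  suffices; single letters are the base because the empty word is excluded.\<close>

lemma spanned_word:
  "w \<noteq> [] \<Longrightarrow> set w \<subseteq> generators G \<Longrightarrow> spanned (word_degree w) (Poly_Mapping.single w c)"
proof (induction w rule: induct_list012)
  case (2 x)
  then show ?case
    using spanned_ve spanned_ed spanned_gh
    by (auto simp: generators_def single_singleton word_degree_def)
next
  case (3 x y w)
  have "word_degree (x # y # w) = generator_degree x + word_degree (y # w)"
    by (simp add: word_degree_def)
  moreover have "spanned (word_degree (y # w)) (Poly_Mapping.single (y # w) c)" using 3 by simp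
  ultimately show ?case
    using 3 spanned_ve_left spanned_ed_left spanned_gh_left
    by (auto simp: generators_def single_Cons[of x "y # w"])
qed simp

lemma spanned_homogeneous:
  assumes x: "x \<in> S" "hom_part n x = x"
  shows "spanned n x"
proof -
  have "spanned n (\<Sum>w\<in>W. Poly_Mapping.single w (Poly_Mapping.lookup x w))"
    if "finite W" "W \<subseteq> Poly_Mapping.keys x" for W
    using that
  proof (induction W rule: finite_induct)
    case (insert w W)
    then have "w \<noteq> []" "set w \<subseteq> generators G" "word_degree w = n"
      using x by (auto simp: S_def carrier_free_algebra hom_part_eq_iff)
    then show ?case using insert spanned_add spanned_word[of w] by auto
  qed (simp add: spanned_zero)
  from this[of "Poly_Mapping.keys x"] show ?thesis by (simp add: poly_mapping_sum_single)
qed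

text \<open>By local units, an ideal above \<open>I\<close> that contains all vertices contains
  every homogeneous element. This supplies the idempotent \<open>v\<close> outside
  \<open>M\<close>.\<close>

lemma vertex_notin_proper_ideal:
  assumes P: "is_ideal P" "I \<subseteq> P" "P \<noteq> S"
  shows "\<exists>v\<in>verts G. letter (Vertex v) \<notin> P"
proof (rule ccontr)
  assume "\<not> ?thesis"
  then have v: "letter (Vertex v) \<in> P" if "v \<in> verts G" for v using that by blast
  have "x \<in> P" if x: "x \<in> S" for x
  proof (rule ideal_of_parts[OF P(1)])
    fix n
    have nS: "hom_part n x \<in> S" using x by simp
    have "spanned n (hom_part n x)" by (rule spanned_homogeneous[OF nS]) (simp add: hom_part_hom_part)
    then have "has_local_unit (hom_part n x)" using filt_local_unit by (auto simp: spanned_def)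
    then obtain W where W: "W \<subseteq> verts G"
      "congr I (\<Sum>v\<in>W. letter (Vertex v) * hom_part n x) (hom_part n x)"
      unfolding has_local_unit_def by (metis order_refl)
    have "(\<Sum>v\<in>W. letter (Vertex v) * hom_part n x) \<in> P"
      using W(1) by (intro ideal_sum[OF P(1)] ideal_mult_right[OF P(1)] v nS) auto
    then show "hom_part n x \<in> P" using congr_mem_iff[OF is_ideal_I P(1,2) W(2)] by simp
  qed
  then show False using P(3) ideal_subset[OF P(1)] by blast
qed

lemma leavitt_unique_maximal_graded:
  assumes M: "maximal_over I M" and unique: "\<And>N. maximal_over I N \<Longrightarrow> N = M"
  shows "graded M"
proof (rule unique_maximal_graded[OF is_ideal_I graded_I _ _ M unique])
  show "\<exists>u\<in>J. u * x - x \<in> I"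
    if "is_ideal J" "graded J" "I \<subseteq> J" "x \<in> J" "hom_part n x = x" for J x n
    using spanned_left_unit[OF that(1,3) spanned_homogeneous[OF ideal_subset[OF that(1,4)] that(5)]
        that(4)] .
  fix P assume P: "is_ideal P" "I \<subseteq> P" "P \<noteq> S"
  obtain v where v: "v \<in> verts G" "letter (Vertex v) \<notin> P"
    using vertex_notin_proper_ideal[OF P] by blast
  moreover have "letter (Vertex v) * letter (Vertex v) - letter (Vertex v) \<in> I"
    using ve_ve[OF v(1) v(1)] by (simp add: congr_def)
  ultimately show "\<exists>v\<in>S. hom_part 0 v = v \<and> v * v - v \<in> I \<and> v \<notin> P"
    by (intro bexI[of _ "letter (Vertex v)"]) (auto simp: hom_part_letter letter_in_S)
qed

section \<open>Transfer to the Leavitt path algebra\<close>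

interpretation graded_quotient S hom_part "free_algebra (generators G)" I
proof
  show "is_ideal I" "graded I" by (rule is_ideal_I graded_I)+
qed (simp_all add: S_def free_algebra_def)

lemma Q_eq: "Q = leavitt_path_algebra G"
  unfolding Q_def unfolding leavitt_path_algebra_def I_def ..

lemma component_eq: "component = leavitt_component G"
proof
  fix n
  show "component n = leavitt_component G n"
    unfolding component_def coset_def unfolding leavitt_component_def I_def S_def hom_part_eq_iff
    by blast
qed

lemma unique_maximal_ideal_graded:
  fixes M :: "(('v, 'e) generator list \<Rightarrow>\<^sub>0 'k) set set"
  assumes M: "maximal_ideal M (leavitt_path_algebra G)"
    and unique: "\<And>N. maximal_ideal N (leavitt_path_algebra G) \<Longrightarrow> N = M"
  shows "graded_ideal (leavitt_path_algebra G) (leavitt_component G) M"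
  unfolding Q_eq[symmetric] component_eq[symmetric]
proof (rule graded_ideal_Q)
  have M': "maximal_ideal M Q" using M by (simp add: Q_eq)
  then show "two_sided_ideal M Q" by (simp add: maximal_ideal_def proper_ideal_def)
  show "graded (preimage M)"
  proof (rule leavitt_unique_maximal_graded[OF maximal_over_preimage[OF M']])
    fix N assume N: "maximal_over I N"
    then have "coset ` N = M" using unique maximal_ideal_image[OF N] by (simp add: Q_eq)
    then show "N = preimage M" using preimage_image[of N] N by (auto simp: maximal_over_def)
  qed
qed

end

theorem theorem3p6:
  fixes G :: "('v, 'e) pre_digraph"
    and M :: "(('v, 'e) generator list \<Rightarrow>\<^sub>0 'k::field) set set"
  assumes "wf_digraph G"
    and "maximal_ideal M (leavitt_path_algebra G)"
    and "\<And>N. maximal_ideal N (leavitt_path_algebra G) \<Longrightarrow> N = M"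
  shows "graded_ideal (leavitt_path_algebra G) (leavitt_component G) M"
  using assms by (rule unique_maximal_ideal_graded)

end
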